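(* Let $\mathcal{M}$ be a class of models. The problem of deciding, given a model $M\in\mathcal{M}$ over a feature set $X$, an entity $e$ over $X$ and a feature $x\in X$, whether $x$ is necessary for the prediction $M(e)$, can be solved in time $O(\mathrm{eval}(M)\,|\mathcal{D}_x|)$, where $\mathrm{eval}(M)$ denotes the time required to evaluate the model $M$ (on an entity). In particular, the problem is solvable in polynomial time for the class of boolean binary classifiers that can be evaluated in polynomial time (which contains the class of DNF formulas and the class of general binary decision diagrams).
   Context: $X$ is a finite set of features. Each feature $x\in X$ has a domain $\mathcal{D}_x$, which is a finite set if $x$ is categorical and an interval $[m_x,M_x]$ (possibly with infinite endpoints) if $x$ is numerical; the time bound is meaningful when $\mathcal{D}_x$ is finite. An entity over $X$ is a function $e$ with $e(x)\in\mathcal{D}_x$ for all $x\in X$. A $k$-class model over $X$ is a map $M$ from entities to $\{0,\dots,k-1\}$. A boolean classifier is a $2$-class model; a model is binary if all its features are categorical with $|\mathcal{D}_x|=2$. A (binary) decision diagram is a boolean binary model given by a rooted directed acyclic graph whose internal nodes have two ordered out-neighbours and are labeled with a feature, and whose leaves are labeled $0$ or $1$, evaluated by following from the root the left (right) out-neighbour if the value of the node's feature is $0$ (is $1$). A set $S\subseteq X$ is a reason for $M(e)$ if $M(e')=M(e)$ for every entity $e'$ with $e'(y)=e(y)$ for all $y\in S$. A sufficient reason is a reason that is minimal under inclusion. A feature $x$ is necessary for $M(e)$ if $x\in S$ for every sufficient reason $S$ for $M(e)$. *)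

theory Defs
  imports
    Complex_Main
    "HOL-Library.FuncSet"
    "HOL-Library.Extended_Real"
    "HOL-Library.Log_Nat"
    "HOL-Computational_Algebra.Polynomial"
begin

section \<open>Reasons and necessary features\<close>

text \<open>
  The entities over a feature set \<open>X\<close> with domains \<open>D\<close> are the elements of \<open>PiE X D\<close>.
\<close>

definition reason ::
  "'f set \<Rightarrow> ('f \<Rightarrow> 'v set) \<Rightarrow> (('f \<Rightarrow> 'v) \<Rightarrow> 'c) \<Rightarrow> ('f \<Rightarrow> 'v) \<Rightarrow> 'f set \<Rightarrow> bool" where
  "reason X D M e S \<longleftrightarrow>
     S \<subseteq> X \<and> (\<forall>e' \<in> PiE X D. (\<forall>y\<in>S. e' y = e y) \<longrightarrow> M e' = M e)"

definition sufficient_reason ::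
  "'f set \<Rightarrow> ('f \<Rightarrow> 'v set) \<Rightarrow> (('f \<Rightarrow> 'v) \<Rightarrow> 'c) \<Rightarrow> ('f \<Rightarrow> 'v) \<Rightarrow> 'f set \<Rightarrow> bool" where
  "sufficient_reason X D M e S \<longleftrightarrow>
     reason X D M e S \<and> (\<forall>S'. S' \<subset> S \<longrightarrow> \<not> reason X D M e S')"

definition necessary ::
  "'f set \<Rightarrow> ('f \<Rightarrow> 'v set) \<Rightarrow> (('f \<Rightarrow> 'v) \<Rightarrow> 'c) \<Rightarrow> ('f \<Rightarrow> 'v) \<Rightarrow> 'f \<Rightarrow> bool" where
  "necessary X D M e x \<longleftrightarrow> (\<forall>S. sufficient_reason X D M e S \<longrightarrow> x \<in> S)"


section \<open>Random access machines\<close>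

text \<open>
  Structured programs for a random access machine whose memory words are real numbers. There are
  registers, a working memory that is addressed indirectly, and a read-only input, which is a list
  of arrays. \<open>Apply r f a b\<close> applies a primitive binary operation of the machine; a machine is
  determined by the set of its primitive operations.
\<close>

datatype prog =
    Skip
  | Const nat nat
  | Apply nat "real \<Rightarrow> real \<Rightarrow> real" nat nat
  | Load nat nat
  | Store nat nat
  | Read nat nat nat
  | Seq prog prog
  | IfLess nat nat prog prog
  | WhileLess nat nat prog

fun operations :: "prog \<Rightarrow> (real \<Rightarrow> real \<Rightarrow> real) set" where
  "operations (Apply r f a b) = {f}"
| "operations (Seq p q) = operations p \<union> operations q"
| "operations (IfLess a b p q) = operations p \<union> operations q"
| "operations (WhileLess a b p) = operations p"
| "operations _ = {}"

type_synonym input = "real list list"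

definition input_word :: "input \<Rightarrow> nat \<Rightarrow> nat \<Rightarrow> real" where
  "input_word I k i = (if k < length I \<and> i < length (I ! k) then I ! k ! i else 0)"

type_synonym state = "(nat \<Rightarrow> real) \<times> (nat \<Rightarrow> real)"

text \<open>
  \<open>exec I p s t s'\<close>: on input \<open>I\<close>, program \<open>p\<close> started in state \<open>s = (registers, memory)\<close>
  terminates in state \<open>s'\<close> after \<open>t\<close> steps. An address that is not a natural number makes the
  program fail, i.e., it has no terminating execution. Execution is deterministic.
\<close>

inductive exec :: "input \<Rightarrow> prog \<Rightarrow> state \<Rightarrow> nat \<Rightarrow> state \<Rightarrow> bool" for I where
  Skip: "exec I Skip s 1 s"
| Const: "exec I (Const r n) (R, W) 1 (R(r := real n), W)"
| Apply: "exec I (Apply r f a b) (R, W) 1 (R(r := f (R a) (R b)), W)"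
| Load: "R a = real i \<Longrightarrow> exec I (Load r a) (R, W) 1 (R(r := W i), W)"
| Store: "R a = real i \<Longrightarrow> exec I (Store a r) (R, W) 1 (R, W(i := R r))"
| Read: "R a = real i \<Longrightarrow> exec I (Read r k a) (R, W) 1 (R(r := input_word I k i), W)"
| Seq: "exec I p s t s' \<Longrightarrow> exec I q s' u s'' \<Longrightarrow> exec I (Seq p q) s (t + u) s''"
| IfTrue: "R a < R b \<Longrightarrow> exec I p (R, W) t s' \<Longrightarrow> exec I (IfLess a b p q) (R, W) (t + 1) s'"
| IfFalse: "\<not> R a < R b \<Longrightarrow> exec I q (R, W) t s' \<Longrightarrow> exec I (IfLess a b p q) (R, W) (t + 1) s'"
| WhileFalse: "\<not> R a < R b \<Longrightarrow> exec I (WhileLess a b p) (R, W) 1 (R, W)"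
| WhileTrue: "R a < R b \<Longrightarrow> exec I p (R, W) t s' \<Longrightarrow> exec I (WhileLess a b p) s' u s'' \<Longrightarrow>
    exec I (WhileLess a b p) (R, W) (t + u + 1) s''"

text \<open>Registers and memory are initially zero, and the output is left in register 0.\<close>

definition computes_within :: "prog \<Rightarrow> input \<Rightarrow> nat \<Rightarrow> nat \<Rightarrow> bool" where
  "computes_within p I v T \<longleftrightarrow>
     (\<exists>t R W. exec I p (\<lambda>_. 0, \<lambda>_. 0) t (R, W) \<and> t \<le> T \<and> R 0 = real v)"

text \<open>
  On integer inputs, the unit-cost machine with addition and subtraction as its only operations
  (in particular, without multiplication) is polynomially equivalent to Turing machines.
\<close>

definition basic_operations :: "(real \<Rightarrow> real \<Rightarrow> real) set" where
  "basic_operations = {(+), (-)}"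

text \<open>Total length in bits of an input consisting of natural numbers.\<close>

definition input_size :: "input \<Rightarrow> nat" where
  "input_size I = (\<Sum>ws\<leftarrow>I. \<Sum>w\<leftarrow>ws. 1 + floorlog 2 (nat \<lfloor>w\<rfloor>))"


section \<open>Models\<close>

text \<open>The elements of a categorical domain of size \<open>n\<close> are numbered from \<open>0\<close> to \<open>n - 1\<close>.\<close>

datatype feature_domain = Categorical nat | Numerical ereal ereal

fun domain_values :: "feature_domain \<Rightarrow> real set" where
  "domain_values (Categorical n) = real ` {..<n}"
| "domain_values (Numerical l u) = {v. l \<le> ereal v \<and> ereal v \<le> u}"

text \<open>
  The features are the positions of the list of domains. A model comes with the description by
  which it is given to an algorithm, e.g., an encoding of a formula or of a diagram.
\<close>

record model =
  domains :: "feature_domain list"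
  classes :: nat
  predict :: "(nat \<Rightarrow> real) \<Rightarrow> nat"
  description :: "real list"

definition features :: "model \<Rightarrow> nat set" where
  "features M = {..<length (domains M)}"

definition feature_values :: "model \<Rightarrow> nat \<Rightarrow> real set" where
  "feature_values M x = domain_values (domains M ! x)"

definition entities :: "model \<Rightarrow> (nat \<Rightarrow> real) set" where
  "entities M = PiE (features M) (feature_values M)"

definition wf_model :: "model \<Rightarrow> bool" where
  "wf_model M \<longleftrightarrow> (\<forall>e \<in> entities M. predict M e < classes M)"

definition boolean_binary :: "model \<Rightarrow> bool" where
  "boolean_binary M \<longleftrightarrow> wf_model M \<and> classes M = 2 \<and>
     (\<forall>D \<in> set (domains M). (\<exists>n. D = Categorical n) \<and> card (domain_values D) = 2)"

definition necessary_feature :: "model \<Rightarrow> (nat \<Rightarrow> real) \<Rightarrow> nat \<Rightarrow> bool" where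
  "necessary_feature M e x \<longleftrightarrow> necessary (features M) (feature_values M) (predict M) e x"


section \<open>Evaluating models and deciding necessity\<close>

text \<open>An endpoint of an interval is given by a flag and, if it is finite, its value.\<close>

definition endpoint_words :: "ereal \<Rightarrow> real list" where
  "endpoint_words a =
     (if a = \<infinity> then [2, 0] else if a = -\<infinity> then [1, 0] else [0, real_of_ereal a])"

fun domain_words :: "feature_domain \<Rightarrow> real list" where
  "domain_words (Categorical n) = [0, real n, 0, 0, 0]"
| "domain_words (Numerical l u) = 1 # endpoint_words l @ endpoint_words u"

text \<open>Arrays 2 to 6 hold, for \<open>j < 5\<close>, the \<open>j\<close>-th words of the domains of all features.\<close>

definition model_input :: "model \<Rightarrow> input" where
  "model_input M =
     [[real (length (domains M)), real (classes M), real (length (description M))],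
      description M] @
     map (\<lambda>j. map (\<lambda>D. domain_words D ! j) (domains M)) [0..<5]"

definition evaluation_input :: "model \<Rightarrow> (nat \<Rightarrow> real) \<Rightarrow> input" where
  "evaluation_input M e = model_input M @ [map e [0..<length (domains M)]]"

definition necessity_input :: "model \<Rightarrow> (nat \<Rightarrow> real) \<Rightarrow> nat \<Rightarrow> input" where
  "necessity_input M e x = evaluation_input M e @ [[real x]]"

text \<open>A single program \<open>p\<close> evaluates all models \<open>M\<close> of the class on all entities \<open>e\<close>.\<close>

definition evaluable_within ::
  "(real \<Rightarrow> real \<Rightarrow> real) set \<Rightarrow> model set \<Rightarrow> (model \<Rightarrow> (nat \<Rightarrow> real) \<Rightarrow> nat) \<Rightarrow> bool" where
  "evaluable_within Ops \<M> T \<longleftrightarrow>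
     (\<exists>p. operations p \<subseteq> Ops \<and>
        (\<forall>M\<in>\<M>. \<forall>e\<in>entities M. computes_within p (evaluation_input M e) (predict M e) (T M e)))"

text \<open>Only features with finite domains are considered.\<close>

definition necessity_decidable_within ::
  "(real \<Rightarrow> real \<Rightarrow> real) set \<Rightarrow> model set \<Rightarrow> (model \<Rightarrow> (nat \<Rightarrow> real) \<Rightarrow> nat \<Rightarrow> nat) \<Rightarrow> bool"
  where
  "necessity_decidable_within Ops \<M> T \<longleftrightarrow>
     (\<exists>p. operations p \<subseteq> Ops \<and>
        (\<forall>M\<in>\<M>. \<forall>e\<in>entities M. \<forall>x\<in>features M. finite (feature_values M x) \<longrightarrow>
           computes_within p (necessity_input M e x)
             (if necessary_feature M e x then 1 else 0) (T M e x)))"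

definition discrete :: "model \<Rightarrow> bool" where
  "discrete M \<longleftrightarrow> (\<forall>ws \<in> set (model_input M). set ws \<subseteq> \<nat>) \<and>
     (\<forall>x \<in> features M. feature_values M x \<subseteq> \<nat>)"

definition evaluable_in_polynomial_time :: "model set \<Rightarrow> bool" where
  "evaluable_in_polynomial_time \<M> \<longleftrightarrow> (\<forall>M\<in>\<M>. discrete M) \<and>
     (\<exists>q :: nat poly. evaluable_within basic_operations \<M>
        (\<lambda>M e. poly q (input_size (evaluation_input M e))))"

definition necessity_decidable_in_polynomial_time :: "model set \<Rightarrow> bool" where
  "necessity_decidable_in_polynomial_time \<M> \<longleftrightarrow> (\<forall>M\<in>\<M>. discrete M) \<and>
     (\<exists>q :: nat poly. necessity_decidable_within basic_operations \<M>
        (\<lambda>M e x. poly q (input_size (necessity_input M e x))))"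


section \<open>DNF formulas\<close>

text \<open>The literal \<open>(x, True)\<close> is the feature \<open>x\<close> and \<open>(x, False)\<close> is its negation.\<close>

type_synonym dnf = "(nat \<times> bool) list list"

definition dnf_holds :: "dnf \<Rightarrow> (nat \<Rightarrow> real) \<Rightarrow> bool" where
  "dnf_holds \<phi> e \<longleftrightarrow> (\<exists>t \<in> set \<phi>. \<forall>(x, b) \<in> set t. e x = (if b then 1 else 0))"

definition literal_words :: "nat \<times> bool \<Rightarrow> real list" where
  "literal_words l = [if snd l then 1 else 2, real (fst l)]"

text \<open>Every term is terminated by the word 0.\<close>

definition dnf_words :: "dnf \<Rightarrow> real list" where
  "dnf_words \<phi> = concat (map (\<lambda>t. concat (map literal_words t) @ [0]) \<phi>)"

definition dnf_model :: "nat \<Rightarrow> dnf \<Rightarrow> model" where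
  "dnf_model n \<phi> =
     \<lparr>domains = replicate n (Categorical 2), classes = 2,
      predict = (\<lambda>e. if dnf_holds \<phi> e then 1 else 0), description = dnf_words \<phi>\<rparr>"

definition dnf_models :: "model set" where
  "dnf_models = {dnf_model n \<phi> | n \<phi>. \<forall>t \<in> set \<phi>. \<forall>l \<in> set t. fst l < n}"


section \<open>Binary decision diagrams\<close>

text \<open>\<open>Decision x l r\<close> is a node labeled \<open>x\<close> with left out-neighbour \<open>l\<close> and right one \<open>r\<close>.\<close>

datatype bdd_node = Leaf bool | Decision nat nat nat

record bdd =
  nodes :: "bdd_node list"
  root :: nat

definition bdd_edges :: "bdd \<Rightarrow> (nat \<times> nat) set" where
  "bdd_edges B = {(v, w). v < length (nodes B) \<and>
     (\<exists>x l r. nodes B ! v = Decision x l r \<and> (w = l \<or> w = r))}"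

definition wf_bdd :: "nat \<Rightarrow> bdd \<Rightarrow> bool" where
  "wf_bdd n B \<longleftrightarrow>
     (\<forall>x l r. Decision x l r \<in> set (nodes B) \<longrightarrow>
        x < n \<and> l < length (nodes B) \<and> r < length (nodes B)) \<and>
     acyclic (bdd_edges B) \<and>
     root B < length (nodes B) \<and>
     (\<forall>v < length (nodes B). (root B, v) \<in> (bdd_edges B)\<^sup>*)"

inductive bdd_reaches :: "bdd \<Rightarrow> (nat \<Rightarrow> real) \<Rightarrow> nat \<Rightarrow> bool \<Rightarrow> bool" for B e where
  leaf: "nodes B ! v = Leaf b \<Longrightarrow> bdd_reaches B e v b"
| left: "nodes B ! v = Decision x l r \<Longrightarrow> e x = 0 \<Longrightarrow> bdd_reaches B e l b \<Longrightarrow> bdd_reaches B e v b"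
| right: "nodes B ! v = Decision x l r \<Longrightarrow> e x = 1 \<Longrightarrow> bdd_reaches B e r b \<Longrightarrow> bdd_reaches B e v b"

fun node_words :: "bdd_node \<Rightarrow> real list" where
  "node_words (Leaf b) = [0, if b then 1 else 0, 0]"
| "node_words (Decision x l r) = [real (x + 1), real l, real r]"

definition bdd_model :: "nat \<Rightarrow> bdd \<Rightarrow> model" where
  "bdd_model n B =
     \<lparr>domains = replicate n (Categorical 2), classes = 2,
      predict = (\<lambda>e. if bdd_reaches B e (root B) True then 1 else 0),
      description = real (root B) # concat (map node_words (nodes B))\<rparr>"

definition bdd_models :: "model set" where
  "bdd_models = {bdd_model n B | n B. wf_bdd n B}"

end

theory Submission
  imports Defs
begin

text \<open>
  Since every reason contains a sufficient one, \<open>x\<close> is necessary iff \<open>X - {x}\<close> is not a reason,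
  i.e., iff the prediction changes for some value of \<open>x\<close>. This is tested by evaluating the model on
  \<open>e\<close> and on \<open>e(x := v)\<close> for all values \<open>v\<close>. A numerical domain that is finite and nonempty is a
  singleton, in which case \<open>x\<close> is not necessary. On the machine, the evaluations are carried out by
  a simulation of the given program in which reading \<open>e x\<close> yields \<open>v\<close>; between two evaluations the
  working memory must be restored in time linear in the evaluation time.
\<close>


section \<open>Necessary features\<close>

text \<open>The bound has to be linear in the running time of an arbitrary program. The input is
  read-only, and copying \<open>e\<close> would cost the number of features, which may exceed the
  evaluation time; hence \<open>e(x := v)\<close> is never built and only reads of the entity array
  are intercepted. The necessity input has one array more than the evaluation input, and it must
  stay invisible to the given program. The overhead depends only on that program, through a bound
  \<open>m\<close> on its registers: at most 4 steps per simulated step, at most one log entry per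
  step with 4 steps to undo it, and \<open>m + 1\<close> steps for clearing registers. Since every
  run takes at least one step, all additive constants disappear in the factor, which ends as
  \<open>m + 23\<close>. Running times may depend on the entity up to the last step, because a
  polynomial bound in the input size does, while in the bound with
  \<open>card (feature_values M x)\<close> they are constant over the entities of a model.\<close>

lemma necessary_iff_prediction_changes:
  assumes "finite X" and e: "e \<in> PiE X D" and x: "x \<in> X"
  shows "necessary X D M e x \<longleftrightarrow> (\<exists>v\<in>D x. M (e(x := v)) \<noteq> M e)"
proof -
  have reason_iff: "reason X D M e (X - {x}) \<longleftrightarrow> (\<forall>v\<in>D x. M (e(x := v)) = M e)"
  proof
    assume r: "reason X D M e (X - {x})"
    show "\<forall>v\<in>D x. M (e(x := v)) = M e"
    proof
      fix v assume "v \<in> D x"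
      then have "e(x := v) \<in> PiE X D"
        using e x by (auto simp: PiE_iff extensional_def)
      then show "M (e(x := v)) = M e"
        using r by (auto simp: reason_def)
    qed
  next
    assume *: "\<forall>v\<in>D x. M (e(x := v)) = M e"
    have "M e' = M e" if e': "e' \<in> PiE X D" and eq: "\<forall>y\<in>X - {x}. e' y = e y" for e'
    proof -
      \<comment> \<open>Off \<open>X\<close> both sides are \<open>undefined\<close>, as members of
        \<open>PiE\<close>, so agreement on \<open>X - {x}\<close> suffices.\<close>
      have "e' = e(x := e' x)"
      proof
        fix y
        show "e' y = (e(x := e' x)) y"
          using e e' eq x by (cases "y \<in> X") (auto simp: PiE_iff extensional_def)
      qed
      moreover have "e' x \<in> D x" using e' x by auto
      ultimately show ?thesis using * by metis
    qed
    then show "reason X D M e (X - {x})" by (auto simp: reason_def)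
  qed
  have "necessary X D M e x \<longleftrightarrow> \<not> reason X D M e (X - {x})"
  proof
    assume nec: "necessary X D M e x"
    show "\<not> reason X D M e (X - {x})"
    proof
      assume r: "reason X D M e (X - {x})"
      \<comment> \<open>A reason that is minimal inside \<open>X - {x}\<close> is minimal among all
        reasons, as its subsets also lie inside.\<close>
      let ?A = "{S. S \<subseteq> X - {x} \<and> reason X D M e S}"
      have "finite ?A" "?A \<noteq> {}"
        using \<open>finite X\<close> r by auto
      then have "\<exists>S\<in>?A. \<forall>S'\<in>?A. S' \<subseteq> S \<longrightarrow> S = S'"
        by (rule finite_has_minimal)
      then obtain S where S: "S \<in> ?A" and min: "\<forall>S'\<in>?A. S' \<subseteq> S \<longrightarrow> S = S'"
        by (elim bexE)
      have "\<not> reason X D M e S'" if "S' \<subset> S" for S'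
      proof
        assume "reason X D M e S'"
        then have "S' \<in> ?A" using S that by auto
        then show False using min that by auto
      qed
      then have "sufficient_reason X D M e S"
        unfolding sufficient_reason_def using S by simp
      then show False using nec S by (auto simp: necessary_def)
    qed
  next
    assume r: "\<not> reason X D M e (X - {x})"
    \<comment> \<open>Reasons are closed under supersets within \<open>X\<close>, so one that avoids
      \<open>x\<close> would make \<open>X - {x}\<close> a reason.\<close>
    have "x \<in> S" if "reason X D M e S" for S
    proof (rule ccontr)
      assume "x \<notin> S"
      then have "S \<subseteq> X - {x}" using that by (auto simp: reason_def)
      then have "\<forall>y\<in>S. e' y = e y" if "\<forall>y\<in>X - {x}. e' y = e y" for e'
        using that by blast
      then have "reason X D M e (X - {x})"
        using that unfolding reason_def by blast
      then show False using r by simp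
    qed
    then show "necessary X D M e x"
      by (auto simp: necessary_def sufficient_reason_def)
  qed
  then show ?thesis using reason_iff by auto
qed


section \<open>A weakest precondition calculus with running times\<close>

text \<open>Execution is deterministic, so the existence of one suitable run already means total
  correctness. Time comes first in the postcondition, which makes sequencing a partial
  application.\<close>

definition wp :: "input \<Rightarrow> prog \<Rightarrow> (nat \<Rightarrow> state \<Rightarrow> bool) \<Rightarrow> state \<Rightarrow> bool" where
  "wp I p Q s \<longleftrightarrow> (\<exists>t s'. exec I p s t s' \<and> Q t s')"

lemma wp_mono: "wp I p Q s \<Longrightarrow> (\<And>t s'. Q t s' \<Longrightarrow> Q' t s') \<Longrightarrow> wp I p Q' s"
  unfolding wp_def by blast

lemma wp_simps:
  "wp I Skip Q s \<longleftrightarrow> Q 1 s"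
  "wp I (Const r n) Q (R, W) \<longleftrightarrow> Q 1 (R(r := real n), W)"
  "wp I (Apply r f a b) Q (R, W) \<longleftrightarrow> Q 1 (R(r := f (R a) (R b)), W)"
  "wp I (Load r a) Q (R, W) \<longleftrightarrow> (\<exists>i. R a = real i \<and> Q 1 (R(r := W i), W))"
  "wp I (Store a r) Q (R, W) \<longleftrightarrow> (\<exists>i. R a = real i \<and> Q 1 (R, W(i := R r)))"
  "wp I (Read r k a) Q (R, W) \<longleftrightarrow> (\<exists>i. R a = real i \<and> Q 1 (R(r := input_word I k i), W))"
  "wp I (Seq p q) Q s \<longleftrightarrow> wp I p (\<lambda>t. wp I q (\<lambda>u. Q (t + u))) s"
  "wp I (IfLess a b p q) Q (R, W) \<longleftrightarrow>
     (if R a < R b then wp I p (\<lambda>t. Q (t + 1)) (R, W) else wp I q (\<lambda>t. Q (t + 1)) (R, W))"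
        apply (auto simp: wp_def exec.simps[of I Skip])[]
       apply (auto simp: wp_def exec.simps[of I "Const r n"])[]
      apply (auto simp: wp_def exec.simps[of I "Apply r f a b"])[]
     apply (auto simp: wp_def exec.simps[of I "Load r a"])[]
    apply (auto simp: wp_def exec.simps[of I "Store a r"])[]
   apply (auto simp: wp_def exec.simps[of I "Read r k a"])[]
  apply (simp add: wp_def exec.simps[of I "Seq p q"], blast)[]
  apply (simp add: wp_def exec.simps[of I "IfLess a b p q"], fastforce)[]
  done

lemma wp_WhileLess:
  "wp I (WhileLess a b p) Q (R, W) \<longleftrightarrow>
     (if R a < R b then wp I p (\<lambda>t. wp I (WhileLess a b p) (\<lambda>u. Q (t + u + 1))) (R, W)
      else Q 1 (R, W))"
proof (cases "R a < R b")
  case True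
  then have "exec I (WhileLess a b p) (R, W) t s' \<longleftrightarrow>
      (\<exists>t1 s1 u. exec I p (R, W) t1 s1 \<and> exec I (WhileLess a b p) s1 u s' \<and> t = t1 + u + 1)" for t s'
    by (subst exec.simps) auto
  then show ?thesis using True by (simp add: wp_def) blast
next
  case False
  then show ?thesis unfolding wp_def by (subst exec.simps) auto
qed

text \<open>Iterations may differ in cost, so the bound adds the individual \<open>c j\<close>; this
  preserves evaluation times that depend on the value tried.\<close>

lemma wp_WhileLess_count:
  assumes step: "\<And>j R W. j < n \<Longrightarrow> Inv j (R, W) \<Longrightarrow>
      R a < R b \<and> wp I p (\<lambda>t s. t \<le> c j \<and> Inv (Suc j) s) (R, W)"
    and stop: "\<And>R W. Inv n (R, W) \<Longrightarrow> \<not> R a < R b"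
    and init: "Inv 0 s"
  shows "wp I (WhileLess a b p) (\<lambda>t s. t \<le> (\<Sum>j<n. c j + 1) + 1 \<and> Inv n s) s"
proof -
  \<comment> \<open>The claim is generalised to a start in iteration \<open>k\<close> and proved
    downwards from \<open>k = n\<close>, where the guard fails.\<close>
  have "wp I (WhileLess a b p) (\<lambda>t s. t \<le> (\<Sum>j=k..<n. c j + 1) + 1 \<and> Inv n s) s"
    if "k \<le> n" "Inv k s" for k s
    using that
  proof (induction k arbitrary: s rule: inc_induct)
    case base
    then show ?case using stop by (cases s) (simp add: wp_WhileLess)
  next
    case (step k)
    obtain R W where s: "s = (R, W)" by (cases s)
    have "R a < R b" and body: "wp I p (\<lambda>t s. t \<le> c k \<and> Inv (Suc k) s) (R, W)"
      using assms(1)[of k R W] step s by auto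
    have "(\<Sum>j=k..<n. c j + 1) = c k + 1 + (\<Sum>j=Suc k..<n. c j + 1)"
      using step by (simp add: sum.atLeast_Suc_lessThan)
    then have "wp I p (\<lambda>t. wp I (WhileLess a b p)
        (\<lambda>u s. t + u + 1 \<le> (\<Sum>j=k..<n. c j + 1) + 1 \<and> Inv n s)) (R, W)"
      by (intro wp_mono[OF body] wp_mono[OF step.IH]) auto
    then show ?case using \<open>R a < R b\<close> s by (simp add: wp_WhileLess)
  qed
  from this[of 0 s] init show ?thesis by (simp add: atLeast0LessThan)
qed

text \<open>Even \<open>Skip\<close> and the final test of a loop cost one step. This lets additive
  constants be absorbed into multiples of the running time.\<close>

lemma exec_time_pos: "exec I p s t s' \<Longrightarrow> 0 < t"
  by (induction rule: exec.induct) auto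

lemma computes_within_iff_wp:
  "computes_within p I v T \<longleftrightarrow>
     wp I p (\<lambda>t (R, W). t \<le> T \<and> R 0 = real v) (\<lambda>_. 0, \<lambda>_. 0)"
  unfolding computes_within_def wp_def by auto


section \<open>Repeated evaluation on a modified entity\<close>

text \<open>
  Address \<open>i\<close> of the simulated program becomes \<open>2 * i\<close>, and the odd addresses hold a log of the
  written addresses. Clearing the memory by means of the log takes time linear in the running time,
  so the simulated program can be run again from the initial state. Registers from \<open>m\<close> on are not
  used by the simulated program: \<open>m\<close> is a temporary, \<open>m + 1\<close> the end of the log, \<open>m + 2\<close> the
  constant 2, \<open>m + 3\<close> and \<open>m + 4\<close> an index of array \<open>K\<close> and the value to be read there, \<open>m + 5\<close>
  the constant 0, \<open>m + 6\<close> the constant 1, and \<open>m + 7\<close> receives the output. Array \<open>K + 1\<close> does not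
  exist for the simulated program and hence reads as 0.
\<close>

fun registers :: "prog \<Rightarrow> nat set" where
  "registers Skip = {}"
| "registers (Const r n) = {r}"
| "registers (Apply r f a b) = {r, a, b}"
| "registers (Load r a) = {r, a}"
| "registers (Store a r) = {a, r}"
| "registers (Read r k a) = {r, a}"
| "registers (Seq p q) = registers p \<union> registers q"
| "registers (IfLess a b p q) = {a, b} \<union> registers p \<union> registers q"
| "registers (WhileLess a b p) = {a, b} \<union> registers p"

lemma finite_registers: "finite (registers p)"
  by (induction p) auto

text \<open>Addresses are doubled by addition because multiplication need not be available.
  \<open>IfLess\<close> is the only test, so the index \<open>x\<close> is recognised by the failure
  of two strict comparisons; \<open>v\<close> is then copied by adding zero.\<close>

fun simulate :: "nat \<Rightarrow> nat \<Rightarrow> prog \<Rightarrow> prog" where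
  "simulate m K (Load r a) = Seq (Apply m (+) a a) (Load r m)"
| "simulate m K (Store a r) =
     Seq (Apply m (+) a a)
       (Seq (Store m r) (Seq (Store (m + 1) m) (Apply (m + 1) (+) (m + 1) (m + 2))))"
| "simulate m K (Read r k a) =
     (if k = K then
        IfLess a (m + 3) (Read r K a)
          (IfLess (m + 3) a (Read r K a) (Apply r (+) (m + 4) (m + 5)))
      else if k = Suc K then Const r 0
      else Read r k a)"
| "simulate m K (Seq p q) = Seq (simulate m K p) (simulate m K q)"
| "simulate m K (IfLess a b p q) = IfLess a b (simulate m K p) (simulate m K q)"
| "simulate m K (WhileLess a b p) = WhileLess a b (simulate m K p)"
| "simulate m K p = p"

text \<open>\<open>c\<close> counts the log entries and \<open>F\<close> records the registers from
  \<open>m + 2\<close> on. The last two clauses are what undoing relies on: every nonzero cell is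
  logged, and every entry is a valid even address. Register \<open>m\<close> and the odd cells
  beyond the log are unconstrained.\<close>

definition simulates :: "nat \<Rightarrow> (nat \<Rightarrow> real) \<Rightarrow> nat \<Rightarrow> state \<Rightarrow> state \<Rightarrow> bool" where
  "simulates m F c s \<sigma> \<longleftrightarrow>
     (\<forall>r<m. fst \<sigma> r = fst s r) \<and>
     (\<forall>r\<ge>m + 2. fst \<sigma> r = F r) \<and>
     (\<forall>i. snd \<sigma> (2 * i) = snd s i) \<and>
     fst \<sigma> (m + 1) = real (2 * c + 1) \<and>
     (\<forall>i. snd s i \<noteq> 0 \<longrightarrow> (\<exists>j<c. snd \<sigma> (2 * j + 1) = real (2 * i))) \<and>
     (\<forall>j<c. \<exists>i. snd \<sigma> (2 * j + 1) = real (2 * i))"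

lemma operations_simulate: "operations (simulate m K p) \<subseteq> insert (+) (operations p)"
  by (induction p) auto

text \<open>Data and log have addresses of different parity, so the two writes cannot interfere. The
  new entry covers cell \<open>i\<close>, the old ones cover all other nonzero cells.\<close>

lemma simulates_store:
  assumes "simulates m F c (R, W) (R', W')" "F (m + 2) = 2"
  shows "simulates m F (Suc c) (R, W(i := v))
    (R'(m := u, m + 1 := R' (m + 1) + 2), W'(2 * i := v, 2 * c + 1 := real (2 * i)))"
  unfolding simulates_def
proof (intro conjI allI impI)
  have odd: "2 * j + 1 \<noteq> 2 * k" "2 * k \<noteq> 2 * j + 1" "2 * k \<noteq> Suc (2 * j)" "Suc (2 * j) \<noteq> 2 * k"
    for j k :: nat by presburger+
  note s = assms(1)[unfolded simulates_def fst_conv snd_conv]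
  let ?W' = "W'(2 * i := v, 2 * c + 1 := real (2 * i))"
  show "fst (R'(m := u, m + 1 := R' (m + 1) + 2), ?W') r = fst (R, W(i := v)) r" if "r < m" for r
    using s that by simp
  show "fst (R'(m := u, m + 1 := R' (m + 1) + 2), ?W') r = F r" if "m + 2 \<le> r" for r
    using s that by simp
  show "snd (R'(m := u, m + 1 := R' (m + 1) + 2), ?W') (2 * k) = snd (R, W(i := v)) k" for k
    using s odd by auto
  show "fst (R'(m := u, m + 1 := R' (m + 1) + 2), ?W') (m + 1) = real (2 * Suc c + 1)"
    using s by simp
  show "\<exists>j<Suc c. snd (R'(m := u, m + 1 := R' (m + 1) + 2), ?W') (2 * j + 1) = real (2 * k)"
    if "snd (R, W(i := v)) k \<noteq> 0" for k
  proof (cases "k = i")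
    case True
    then show ?thesis by (intro exI[of _ c]) simp
  next
    case False
    then have "W k \<noteq> 0" using that by simp
    then obtain j where "j < c" "W' (2 * j + 1) = real (2 * k)" using s by blast
    then show ?thesis using odd by (intro exI[of _ j]) auto
  qed
  show "\<exists>k. snd (R'(m := u, m + 1 := R' (m + 1) + 2), ?W') (2 * j + 1) = real (2 * k)"
    if "j < Suc c" for j
  proof (cases "j = c")
    case True
    then show ?thesis by auto
  next
    case False
    then have "j < c" using that by simp
    then obtain k where "W' (2 * j + 1) = real (2 * k)" using s by blast
    then show ?thesis using odd False by (intro exI[of _ k]) auto
  qed
qed

lemma simulates_register:
  assumes "simulates m F c (R, W) (R', W')" "r < m"
  shows "simulates m F c (R(r := v), W) (R'(r := v), W')"
  using assms unfolding simulates_def by simp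

lemma simulates_temporary:
  assumes "simulates m F c (R, W) (R', W')"
  shows "simulates m F c (R, W) (R'(m := v), W')"
  using assms unfolding simulates_def by simp

lemma simulates_frame:
  assumes "simulates m F c s (R', W')" "m + 2 \<le> r"
  shows "simulates m (F(r := v)) c s (R'(r := v), W')"
  using assms unfolding simulates_def by simp

lemma simulatesD:
  assumes "simulates m F c (R, W) (R', W')"
  shows "r < m \<Longrightarrow> R' r = R r" "m + 2 \<le> r \<Longrightarrow> R' r = F r"
    "W' (2 * i) = W i" "R' (m + 1) = real (2 * c + 1)"
proof -
  note s = assms[unfolded simulates_def fst_conv snd_conv]
  show "r < m \<Longrightarrow> R' r = R r" using conjunct1[OF s] by blast
  note s = conjunct2[OF s]
  show "m + 2 \<le> r \<Longrightarrow> R' r = F r" using conjunct1[OF s] by blast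
  note s = conjunct2[OF s]
  show "W' (2 * i) = W i" using conjunct1[OF s] by blast
  show "R' (m + 1) = real (2 * c + 1)" using conjunct1[OF conjunct2[OF s]] .
qed

lemma wp_weaken_bounds:
  fixes A A' B B' :: nat
  assumes "wp I p (\<lambda>t s. t \<le> A \<and> (\<exists>c\<le>B. S c s)) s"
    and "\<And>t. t \<le> A \<Longrightarrow> f t \<le> A'" and "B \<le> B'"
  shows "wp I p (\<lambda>t s. f t \<le> A' \<and> (\<exists>c\<le>B'. S c s)) s"
  using assms(1)
proof (rule wp_mono)
  fix t s'
  assume t: "t \<le> A \<and> (\<exists>c\<le>B. S c s')"
  then obtain c where "c \<le> B" "S c s'" by blast
  then have "\<exists>c\<le>B'. S c s'" using assms(3) by (intro exI[of _ c]) simp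
  then show "f t \<le> A' \<and> (\<exists>c\<le>B'. S c s')" using t assms(2) by simp
qed

text \<open>\<open>I\<close> is the input that the simulated program is to see, \<open>I'\<close>
  the one actually present. \<open>Store\<close> gives the factor 4: doubling, writing, logging,
  advancing the end of the log. It alone extends the log, by one entry, hence at most
  \<open>t\<close> new entries.\<close>

lemma exec_simulate:
  assumes "exec I p s t s'"
    and "registers p \<subseteq> {..<m}"
    and "simulates m F c s \<sigma>"
    and F: "F (m + 2) = 2" "F (m + 3) = real x" "F (m + 4) = v" "F (m + 5) = 0"
    and K: "\<And>i. input_word I K i = (if i = x then v else input_word I' K i)"
    and SucK: "\<And>i. input_word I (Suc K) i = 0"
    and other: "\<And>k i. k \<noteq> K \<Longrightarrow> k \<noteq> Suc K \<Longrightarrow> input_word I k i = input_word I' k i"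
  shows "wp I' (simulate m K p)
    (\<lambda>t' \<sigma>'. t' \<le> 4 * t \<and> (\<exists>c'\<le>c + t. simulates m F c' s' \<sigma>')) \<sigma>"
  using assms(1-3)
proof (induction arbitrary: c \<sigma> rule: exec.induct)
  case (Skip s)
  have "\<exists>c'\<le>c + 1. simulates m F c' s \<sigma>"
    using Skip by (intro exI[of _ c]) simp
  then show ?case by (simp add: wp_simps)
next
  case (Const r n R W)
  obtain R' W' where \<sigma>: "\<sigma> = (R', W')" by (cases \<sigma>)
  have "simulates m F c (R(r := real n), W) (R'(r := real n), W')"
    using Const simulates_register unfolding \<sigma> by simp
  then have "\<exists>c'\<le>c + 1. simulates m F c' (R(r := real n), W) (R'(r := real n), W')"
    by (intro exI[of _ c]) simp
  then show ?case by (simp add: \<sigma> wp_simps)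
next
  case (Apply r f a b R W)
  obtain R' W' where \<sigma>: "\<sigma> = (R', W')" by (cases \<sigma>)
  note sim = Apply.prems(2)[unfolded \<sigma>]
  let ?u = "f (R a) (R b)"
  have "R' a = R a" "R' b = R b" using Apply simulatesD(1)[OF sim] by auto
  moreover have "simulates m F c (R(r := ?u), W) (R'(r := ?u), W')"
    using Apply simulates_register[OF sim] by simp
  then have "\<exists>c'\<le>c + 1. simulates m F c' (R(r := ?u), W) (R'(r := ?u), W')"
    by (intro exI[of _ c]) simp
  ultimately show ?case by (simp add: \<sigma> wp_simps)
next
  case (Load R a i r W)
  obtain R' W' where \<sigma>: "\<sigma> = (R', W')" by (cases \<sigma>)
  note sim = Load.prems(2)[unfolded \<sigma>]
  have "R' a = R a" using Load simulatesD(1)[OF sim] by auto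
  then have a: "R' a + R' a = real (2 * i)" using Load by simp
  have "simulates m F c (R(r := W i), W) (R'(m := real (2 * i), r := W' (2 * i)), W')"
    using simulates_register[OF simulates_temporary[OF sim], of r "W i" "real (2 * i)"]
      Load.prems simulatesD(3)[OF sim] by simp
  then have "\<exists>c'\<le>c + 1. simulates m F c' (R(r := W i), W)
      (R'(m := real (2 * i), r := W' (2 * i)), W')"
    by (intro exI[of _ c]) simp
  then show ?case
    unfolding \<sigma> simulate.simps wp_simps a fun_upd_same
    by (intro exI[of _ "2 * i"]) simp
next
  case (Store R a i r W)
  obtain R' W' where \<sigma>: "\<sigma> = (R', W')" by (cases \<sigma>)
  note sim = Store.prems(2)[unfolded \<sigma>]
  have r: "R' a = R a" "R' r = R r" "r \<noteq> m" using Store simulatesD(1)[OF sim] by auto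
  then have a: "R' a + R' a = real (2 * i)" using Store by simp
  have cnt: "R' (m + 1) = real (2 * c + 1)" "R' (m + 2) = 2"
    using simulatesD(4)[OF sim] simulatesD(2)[OF sim, of "m + 2"] F by simp_all
  have "simulates m F (Suc c) (R, W(i := R r))
    (R'(m := real (2 * i), m + 1 := R' (m + 1) + 2), W'(2 * i := R r, 2 * c + 1 := real (2 * i)))"
    by (rule simulates_store[OF sim F(1)])
  then have "\<exists>c'\<le>c + 1. simulates m F c' (R, W(i := R r))
    (R'(m := real (2 * i), m + 1 := R' (m + 1) + 2), W'(2 * i := R r, 2 * c + 1 := real (2 * i)))"
    by (intro exI[of _ "Suc c"]) simp
  then show ?case
    unfolding \<sigma> simulate.simps wp_simps a
    apply -
    apply (rule exI[of _ "2 * i"], rule conjI, simp)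
    apply (rule exI[of _ "2 * c + 1"], rule conjI)
    using cnt r by simp_all
next
  case (Read R a i r k W)
  obtain R' W' where \<sigma>: "\<sigma> = (R', W')" by (cases \<sigma>)
  note sim = Read.prems(2)[unfolded \<sigma>]
  have a: "R' a = real i" using Read simulatesD(1)[OF sim] by auto
  have "R' (m + 3) = real x" "R' (m + 4) = v" "R' (m + 5) = 0"
    using simulatesD(2)[OF sim] F by simp_all
  moreover have "\<exists>c'\<le>c + 1. simulates m F c' (R(r := u), W) (R'(r := u), W')" for u
    using simulates_register[OF sim] Read.prems by (intro exI[of _ c]) simp
  ultimately show ?case
    by (simp add: \<sigma> wp_simps a K SucK other)
next
  case (Seq p s t s' q u s'')
  have "wp I' (simulate m K p)
      (\<lambda>t' \<sigma>'. t' \<le> 4 * t \<and> (\<exists>c'\<le>c + t. simulates m F c' s' \<sigma>')) \<sigma>"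
    using Seq by simp
  then show ?case
    unfolding simulate.simps wp_simps
  proof (rule wp_mono)
    fix t1 \<sigma>1
    assume t1: "t1 \<le> 4 * t \<and> (\<exists>c'\<le>c + t. simulates m F c' s' \<sigma>1)"
    then obtain c1 where c1: "c1 \<le> c + t" "simulates m F c1 s' \<sigma>1" by blast
    have "wp I' (simulate m K q)
        (\<lambda>t' \<sigma>'. t' \<le> 4 * u \<and> (\<exists>c'\<le>c1 + u. simulates m F c' s'' \<sigma>')) \<sigma>1"
      using Seq c1 by simp
    then show "wp I' (simulate m K q) (\<lambda>t' \<sigma>'. t1 + t' \<le> 4 * (t + u) \<and>
        (\<exists>c'\<le>c + (t + u). simulates m F c' s'' \<sigma>')) \<sigma>1"
      using t1 c1 by (intro wp_weaken_bounds[where f = "\<lambda>t. t1 + t"]) auto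
  qed
next
  case (IfTrue R a b p W t s' q)
  obtain R' W' where \<sigma>: "\<sigma> = (R', W')" by (cases \<sigma>)
  have "R' a = R a" "R' b = R b" using IfTrue by (auto simp: \<sigma> simulatesD)
  moreover have "wp I' (simulate m K p)
      (\<lambda>t' \<sigma>'. t' \<le> 4 * t \<and> (\<exists>c'\<le>c + t. simulates m F c' s' \<sigma>')) \<sigma>"
    using IfTrue by simp
  then have "wp I' (simulate m K p)
      (\<lambda>t' \<sigma>'. t' + 1 \<le> 4 * (t + 1) \<and> (\<exists>c'\<le>c + (t + 1). simulates m F c' s' \<sigma>')) \<sigma>"
    by (rule wp_weaken_bounds) auto
  ultimately show ?case using IfTrue.hyps by (simp add: \<sigma> wp_simps)
next
  case (IfFalse R a b q W t s' p)
  obtain R' W' where \<sigma>: "\<sigma> = (R', W')" by (cases \<sigma>)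
  have "R' a = R a" "R' b = R b" using IfFalse by (auto simp: \<sigma> simulatesD)
  moreover have "wp I' (simulate m K q)
      (\<lambda>t' \<sigma>'. t' \<le> 4 * t \<and> (\<exists>c'\<le>c + t. simulates m F c' s' \<sigma>')) \<sigma>"
    using IfFalse by simp
  then have "wp I' (simulate m K q)
      (\<lambda>t' \<sigma>'. t' + 1 \<le> 4 * (t + 1) \<and> (\<exists>c'\<le>c + (t + 1). simulates m F c' s' \<sigma>')) \<sigma>"
    by (rule wp_weaken_bounds) auto
  ultimately show ?case using IfFalse.hyps by (simp add: \<sigma> wp_simps)
next
  case (WhileFalse R a b p W)
  obtain R' W' where \<sigma>: "\<sigma> = (R', W')" by (cases \<sigma>)
  have "R' a = R a" "R' b = R b" using WhileFalse by (auto simp: \<sigma> simulatesD)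
  moreover have "\<exists>c'\<le>c + 1. simulates m F c' (R, W) (R', W')"
    using WhileFalse \<sigma> by (intro exI[of _ c]) simp
  ultimately show ?case using WhileFalse.hyps
    unfolding \<sigma> simulate.simps by (subst wp_WhileLess) simp
next
  case (WhileTrue R a b p W t s' u s'')
  obtain R' W' where \<sigma>: "\<sigma> = (R', W')" by (cases \<sigma>)
  have "R' a < R' b" using WhileTrue by (auto simp: \<sigma> simulatesD)
  have "wp I' (simulate m K p)
      (\<lambda>t' \<sigma>'. t' \<le> 4 * t \<and> (\<exists>c'\<le>c + t. simulates m F c' s' \<sigma>')) \<sigma>"
    using WhileTrue by simp
  then have "wp I' (simulate m K p) (\<lambda>t1. wp I' (WhileLess a b (simulate m K p))
      (\<lambda>t' \<sigma>'. t1 + t' + 1 \<le> 4 * (t + u + 1) \<and>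
        (\<exists>c'\<le>c + (t + u + 1). simulates m F c' s'' \<sigma>'))) \<sigma>"
  proof (rule wp_mono)
    fix t1 \<sigma>1
    assume t1: "t1 \<le> 4 * t \<and> (\<exists>c'\<le>c + t. simulates m F c' s' \<sigma>1)"
    then obtain c1 where c1: "c1 \<le> c + t" "simulates m F c1 s' \<sigma>1" by blast
    have "wp I' (WhileLess a b (simulate m K p))
        (\<lambda>t' \<sigma>'. t' \<le> 4 * u \<and> (\<exists>c'\<le>c1 + u. simulates m F c' s'' \<sigma>')) \<sigma>1"
      using WhileTrue.IH(2)[of c1 \<sigma>1] WhileTrue.prems c1 by simp
    then show "wp I' (WhileLess a b (simulate m K p))
        (\<lambda>t' \<sigma>'. t1 + t' + 1 \<le> 4 * (t + u + 1) \<and>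
          (\<exists>c'\<le>c + (t + u + 1). simulates m F c' s'' \<sigma>')) \<sigma>1"
      using t1 c1 by (intro wp_weaken_bounds[where f = "\<lambda>t. t1 + t + 1"]) auto
  qed
  then show ?case using \<open>R' a < R' b\<close>
    unfolding \<sigma> simulate.simps by (subst wp_WhileLess) simp
qed

section \<open>Resetting the machine after a simulated run\<close>

fun clear_registers :: "nat \<Rightarrow> prog" where
  "clear_registers 0 = Skip"
| "clear_registers (Suc n) = Seq (clear_registers n) (Const n 0)"

definition undo_log :: "nat \<Rightarrow> prog" where
  "undo_log m = WhileLess (m + 6) (m + 1)
     (Seq (Apply (m + 1) (-) (m + 1) (m + 2)) (Seq (Load m (m + 1)) (Store m (m + 5))))"

text \<open>The output is saved before the registers are cleared; adding the zero in
  \<open>m + 5\<close> acts as a copy instruction.\<close>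

definition evaluate :: "nat \<Rightarrow> nat \<Rightarrow> prog \<Rightarrow> prog" where
  "evaluate m K p = Seq (simulate m K p)
     (Seq (Apply (m + 7) (+) 0 (m + 5)) (Seq (undo_log m) (clear_registers m)))"

lemma operations_clear_registers: "operations (clear_registers n) = {}"
  by (induction n) auto

lemma operations_evaluate: "operations (evaluate m K p) \<subseteq> basic_operations \<union> operations p"
  using operations_simulate[of m K p]
  by (auto simp: evaluate_def undo_log_def operations_clear_registers basic_operations_def)

lemma wp_clear_registers:
  "wp I (clear_registers n) (\<lambda>t s. t = n + 1 \<and> s = (\<lambda>r. if r < n then 0 else R r, W)) (R, W)"
proof (induction n)
  case 0
  then show ?case by (simp add: wp_simps)
next
  case (Suc n)
  show ?case unfolding clear_registers.simps wp_simps
    by (rule wp_mono[OF Suc]) (auto simp: wp_simps fun_eq_iff)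
qed

text \<open>Popping an entry zeroes its cell, which then needs no log entry any more, so the shorter
  log still satisfies \<open>simulates\<close>. Each round costs three instructions and a
  test.\<close>

lemma wp_undo_log:
  assumes "simulates m F c s \<sigma>" and F: "F (m + 2) = 2" "F (m + 5) = 0" "F (m + 6) = 1"
  shows "wp I (undo_log m) (\<lambda>t \<sigma>'. t \<le> 4 * c + 1 \<and> simulates m F 0 (fst s, \<lambda>_. 0) \<sigma>') \<sigma>"
  using assms(1)
proof (induction c arbitrary: s \<sigma>)
  case 0
  obtain R W R' W' where s: "s = (R, W)" "\<sigma> = (R', W')" by (cases s, cases \<sigma>)
  note sim = 0[unfolded s]
  have "W = (\<lambda>_. 0)" using sim by (auto simp: simulates_def fun_eq_iff)
  then show ?case
    using sim simulatesD(4)[OF sim] simulatesD(2)[OF sim, of "m + 6"] F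
    by (simp add: s undo_log_def wp_WhileLess)
next
  case (Suc c)
  have odd: "2 * j + 1 \<noteq> 2 * k" "2 * k \<noteq> 2 * j + 1" "2 * k \<noteq> Suc (2 * j)" "Suc (2 * j) \<noteq> 2 * k"
    for j k :: nat by presburger+
  obtain R W R' W' where s: "s = (R, W)" "\<sigma> = (R', W')" by (cases s, cases \<sigma>)
  note sim = Suc.prems[unfolded s]
  note sim' = sim[unfolded simulates_def fst_conv snd_conv]
  obtain i where i: "W' (2 * c + 1) = real (2 * i)" using sim' by blast
  have regs: "R' (Suc m) - R' (Suc (Suc m)) = real (2 * c + 1)" "1 < R' (Suc m)"
      "R' (m + 5) = 0" "R' (m + 6) = 1"
    using simulatesD(4)[OF sim] simulatesD(2)[OF sim] F by simp_all
  let ?\<sigma> = "(R'(m + 1 := real (2 * c + 1), m := real (2 * i)), W'(2 * i := 0))"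
  have "simulates m F c (R, W(i := 0)) ?\<sigma>"
    unfolding simulates_def fst_conv snd_conv
  proof (intro conjI allI impI)
    show "\<exists>j<c. (W'(2 * i := 0)) (2 * j + 1) = real (2 * k)" if "(W(i := 0)) k \<noteq> 0" for k
    proof -
      have "k \<noteq> i" "W k \<noteq> 0" using that by (auto split: if_splits)
      then obtain j where j: "j < Suc c" "W' (2 * j + 1) = real (2 * k)" using sim' by blast
      \<comment> \<open>Entry \<open>c\<close> names \<open>i\<close>, so the entry of another cell
        \<open>k\<close> is an older one and survives.\<close>
      then have "j \<noteq> c" using i \<open>k \<noteq> i\<close> by auto
      then show ?thesis using j odd by (intro exI[of _ j]) auto
    qed
    show "\<exists>k. (W'(2 * i := 0)) (2 * j + 1) = real (2 * k)" if "j < c" for j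
    proof -
      have "j < Suc c" using that by simp
      then obtain k where "W' (2 * j + 1) = real (2 * k)" using sim' by blast
      then show ?thesis using odd by (intro exI[of _ k]) auto
    qed
  qed (use sim' in auto)
  from Suc.IH[OF this] have "wp I (undo_log m)
      (\<lambda>t \<sigma>'. t \<le> 4 * c + 1 \<and> simulates m F 0 (R, \<lambda>_. 0) \<sigma>') ?\<sigma>"
    by simp
  then have "wp I (undo_log m)
      (\<lambda>t \<sigma>'. 3 + t + 1 \<le> 4 * Suc c + 1 \<and> simulates m F 0 (R, \<lambda>_. 0) \<sigma>') ?\<sigma>"
    by (rule wp_mono) auto
  then show ?case
    using i unfolding s undo_log_def fst_conv
    by (subst wp_WhileLess)
      (simp add: wp_simps regs fun_upd_twist[of m] del: of_nat_mult of_nat_add of_nat_Suc)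
qed

text \<open>Indistinguishable from the initial state for the simulated program. Stale entries may
  remain in odd cells; they lie beyond the end of the log and are never erased.\<close>

abbreviation ready :: "nat \<Rightarrow> (nat \<Rightarrow> real) \<Rightarrow> state \<Rightarrow> bool" where
  "ready m F \<equiv> simulates m F 0 (\<lambda>_. 0, \<lambda>_. 0)"

lemma wp_evaluate:
  assumes comp: "computes_within p I y T"
    and regs: "registers p \<subseteq> {..<m}" "0 < m"
    and ready: "ready m F \<sigma>"
    and F: "F (m + 2) = 2" "F (m + 3) = real x" "F (m + 4) = v" "F (m + 5) = 0" "F (m + 6) = 1"
    and K: "\<And>i. input_word I K i = (if i = x then v else input_word I' K i)"
    and SucK: "\<And>i. input_word I (Suc K) i = 0"
    and other: "\<And>k i. k \<noteq> K \<Longrightarrow> k \<noteq> Suc K \<Longrightarrow> input_word I k i = input_word I' k i"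
  shows "wp I' (evaluate m K p)
    (\<lambda>t \<sigma>'. t \<le> (m + 11) * T \<and> ready m (F(m + 7 := real y)) \<sigma>') \<sigma>"
proof -
  obtain t R W where ex: "exec I p (\<lambda>_. 0, \<lambda>_. 0) t (R, W)" and t: "t \<le> T" and R: "R 0 = real y"
    using comp by (auto simp: computes_within_def)
  have "0 < T" using exec_time_pos[OF ex] t by simp
  then have m: "m \<le> m * T" by simp
  let ?F = "F(m + 7 := real y)"
  show ?thesis
    unfolding evaluate_def wp_simps
  proof (rule wp_mono[OF exec_simulate[OF ex regs(1) ready F(1-4) K SucK other]])
    fix t1 \<sigma>1
    assume "t1 \<le> 4 * t \<and> (\<exists>c'\<le>0 + t. simulates m F c' (R, W) \<sigma>1)"
    then obtain c where c: "c \<le> t" "simulates m F c (R, W) \<sigma>1" and t1: "t1 \<le> 4 * t" by auto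
    obtain R1 W1 where \<sigma>1: "\<sigma>1 = (R1, W1)" by (cases \<sigma>1)
    have "R1 0 = real y" "R1 (m + 5) = 0"
      using simulatesD(1)[OF c(2)[unfolded \<sigma>1]] simulatesD(2)[OF c(2)[unfolded \<sigma>1], of "m + 5"]
        regs R F by simp_all
    moreover have "simulates m ?F c (R, W) (R1(m + 7 := real y), W1)"
      using c \<sigma>1 by (intro simulates_frame) auto
    then have "wp I' (undo_log m)
        (\<lambda>t \<sigma>'. t \<le> 4 * c + 1 \<and> simulates m ?F 0 (R, \<lambda>_. 0) \<sigma>') (R1(m + 7 := real y), W1)"
      using wp_undo_log[of m ?F c "(R, W)"] F by simp
    then have "wp I' (undo_log m) (\<lambda>t. wp I' (clear_registers m)
        (\<lambda>u \<sigma>'. t1 + (1 + (t + u)) \<le> (m + 11) * T \<and> ready m ?F \<sigma>')) (R1(m + 7 := real y), W1)"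
    proof (rule wp_mono)
      fix t2 \<sigma>2
      assume *: "t2 \<le> 4 * c + 1 \<and> simulates m ?F 0 (R, \<lambda>_. 0) \<sigma>2"
      obtain R2 W2 where \<sigma>2: "\<sigma>2 = (R2, W2)" by (cases \<sigma>2)
      \<comment> \<open>With \<open>c <= t <= T\<close> the left side is at most
        \<open>8 * T + m + 3\<close>, and \<open>1 <= T\<close> does the rest.\<close>
      have "t1 + (1 + (t2 + (m + 1))) \<le> (m + 11) * T"
        using * t t1 c m \<open>0 < T\<close> unfolding add_mult_distrib by linarith
      moreover have "ready m ?F (\<lambda>r. if r < m then 0 else R2 r, W2)"
        using * unfolding \<sigma>2 simulates_def by simp
      ultimately show "wp I' (clear_registers m)
          (\<lambda>u \<sigma>'. t1 + (1 + (t2 + u)) \<le> (m + 11) * T \<and> ready m ?F \<sigma>') \<sigma>2"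
        unfolding \<sigma>2 by (intro wp_mono[OF wp_clear_registers]) auto
    qed
    ultimately show "wp I' (Apply (m + 7) (+) 0 (m + 5)) (\<lambda>t. wp I' (undo_log m)
        (\<lambda>u. wp I' (clear_registers m)
          (\<lambda>v \<sigma>'. t1 + (t + (u + v)) \<le> (m + 11) * T \<and> ready m ?F \<sigma>'))) \<sigma>1"
      by (simp add: \<sigma>1 wp_simps)
  qed
qed

text \<open>
  Register \<open>m + 8\<close> holds the prediction on the given entity, \<open>m + 9\<close> first the kind and then the size
  of the domain of \<open>x\<close>, and \<open>m + 10\<close> the answer.
\<close>

definition try_value :: "nat \<Rightarrow> prog \<Rightarrow> prog" where
  "try_value m p = Seq (evaluate m 7 p)
     (Seq (IfLess (m + 7) (m + 8) (Const (m + 10) 1)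
             (IfLess (m + 8) (m + 7) (Const (m + 10) 1) Skip))
        (Apply (m + 4) (+) (m + 4) (m + 6)))"

text \<open>The prediction for \<open>e\<close> is computed as the case \<open>v = e x\<close>, so
  one modified program serves all evaluations. Register \<open>m + 5\<close> is never written and
  provides the constant 0. A numerical domain leads to \<open>Skip\<close>, with register 0 still
  holding the negative answer.\<close>

definition decide_necessity :: "nat \<Rightarrow> prog \<Rightarrow> prog" where
  "decide_necessity m p =
     Seq (Const (m + 1) 1) (Seq (Const (m + 2) 2) (Seq (Const (m + 6) 1)
       (Seq (Read (m + 3) 8 (m + 5)) (Seq (Read (m + 9) 2 (m + 3))
         (IfLess (m + 5) (m + 9) Skip
           (Seq (Read (m + 9) 3 (m + 3)) (Seq (Read (m + 4) 7 (m + 3))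
             (Seq (evaluate m 7 p)
               (Seq (Apply (m + 8) (+) (m + 7) (m + 5)) (Seq (Const (m + 4) 0)
                 (Seq (WhileLess (m + 4) (m + 9) (try_value m p))
                   (Apply 0 (+) (m + 10) (m + 5)))))))))))))"

lemma operations_decide_necessity:
  "operations (decide_necessity m p) \<subseteq> basic_operations \<union> operations p"
  using operations_evaluate[of m 7 p]
  by (auto simp: decide_necessity_def try_value_def basic_operations_def)

lemma wp_try_value:
  assumes comp: "computes_within p I y T"
    and regs: "registers p \<subseteq> {..<m}" "0 < m"
    and ready: "ready m F \<sigma>"
    and F: "F (m + 2) = 2" "F (m + 3) = real x" "F (m + 4) = v" "F (m + 5) = 0" "F (m + 6) = 1"
      "F (m + 8) = real y0"
    and K: "\<And>i. input_word I 7 i = (if i = x then v else input_word I' 7 i)"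
    and SucK: "\<And>i. input_word I 8 i = 0"
    and other: "\<And>k i. k \<noteq> 7 \<Longrightarrow> k \<noteq> 8 \<Longrightarrow> input_word I k i = input_word I' k i"
  shows "wp I' (try_value m p)
    (\<lambda>t \<sigma>'. t \<le> (m + 11) * T + 4 \<and>
       ready m (F(m + 7 := real y, m + 10 := if y = y0 then F (m + 10) else 1, m + 4 := v + 1)) \<sigma>') \<sigma>"
proof -
  have "wp I' (evaluate m 7 p)
      (\<lambda>t \<sigma>'. t \<le> (m + 11) * T \<and> ready m (F(m + 7 := real y)) \<sigma>') \<sigma>"
    using SucK other by (intro wp_evaluate[OF comp regs ready F(1-5) K]) simp_all
  then show ?thesis
    unfolding try_value_def wp_simps(7)
  proof (rule wp_mono)
    fix t \<sigma>1
    assume "t \<le> (m + 11) * T \<and> ready m (F(m + 7 := real y)) \<sigma>1"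
    moreover obtain R W where \<sigma>1: "\<sigma>1 = (R, W)" by (cases \<sigma>1)
    ultimately have t: "t \<le> (m + 11) * T" and sim: "ready m (F(m + 7 := real y)) (R, W)" by auto
    have R: "R (m + 7) = real y" "R (m + 8) = real y0" "R (m + 10) = F (m + 10)"
        "R (m + 4) = v" "R (m + 6) = 1"
      using simulatesD(2)[OF sim] F by simp_all
    let ?F = "F(m + 7 := real y, m + 10 := if y = y0 then F (m + 10) else 1, m + 4 := v + 1)"
    have final: "ready m ?F (R(m + 10 := u, m + 4 := v + 1), W)"
      if "u = (if y = y0 then F (m + 10) else 1)" for u
      unfolding that by (intro simulates_frame sim) simp_all
    have final': "ready m ?F (R(m + 4 := v + 1), W)" if "y = y0"
    proof -
      have "R(m + 10 := F (m + 10)) = R" using R by auto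
      then show ?thesis using final[of "F (m + 10)"] that by simp
    qed
    consider "y = y0" | "y < y0" | "y0 < y" by linarith
    then show "wp I' (IfLess (m + 7) (m + 8) (Const (m + 10) 1)
          (IfLess (m + 8) (m + 7) (Const (m + 10) 1) Skip))
        (\<lambda>u. wp I' (Apply (m + 4) (+) (m + 4) (m + 6))
          (\<lambda>w \<sigma>'. t + (u + w) \<le> (m + 11) * T + 4 \<and> ready m ?F \<sigma>')) \<sigma>1"
    proof cases
      case 1
      then show ?thesis using t R final' unfolding \<sigma>1 by (simp add: wp_simps)
    next
      case 2
      then show ?thesis using t R final[of 1] unfolding \<sigma>1 by (simp add: wp_simps)
    next
      case 3
      then show ?thesis using t R final[of 1] unfolding \<sigma>1 by (simp add: wp_simps)
    qed
  qed
qed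

lemma wp_try_values:
  assumes comp: "\<And>v. v < n \<Longrightarrow> computes_within p (J (real v)) (g v) (T v)"
    and regs: "registers p \<subseteq> {..<m}" "0 < m"
    and ready: "ready m F \<sigma>"
    and F: "F (m + 2) = 2" "F (m + 3) = real x" "F (m + 4) = 0" "F (m + 5) = 0" "F (m + 6) = 1"
      "F (m + 8) = real y0" "F (m + 9) = real n" "F (m + 10) = 0"
    and K: "\<And>v i. input_word (J v) 7 i = (if i = x then v else input_word I' 7 i)"
    and SucK: "\<And>v i. input_word (J v) 8 i = 0"
    and other: "\<And>v k i. k \<noteq> 7 \<Longrightarrow> k \<noteq> 8 \<Longrightarrow> input_word (J v) k i = input_word I' k i"
  shows "wp I' (WhileLess (m + 4) (m + 9) (try_value m p))
    (\<lambda>t (R, W). t \<le> (\<Sum>v<n. (m + 11) * T v + 4 + 1) + 1 \<and> R (m + 5) = 0 \<and>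
       R (m + 10) = (if \<exists>v<n. g v \<noteq> y0 then 1 else 0)) \<sigma>"
proof -
  \<comment> \<open>The frame is existentially quantified because \<open>m + 7\<close> keeps the
    prediction for the last value tried. The flag in \<open>m + 10\<close> is never reset, so it
    remembers any earlier change.\<close>
  define Inv where "Inv j s \<longleftrightarrow> (\<exists>F. ready m F s \<and> F (m + 2) = 2 \<and> F (m + 3) = real x \<and>
      F (m + 4) = real j \<and> F (m + 5) = 0 \<and> F (m + 6) = 1 \<and> F (m + 8) = real y0 \<and>
      F (m + 9) = real n \<and> F (m + 10) = (if \<exists>v<j. g v \<noteq> y0 then 1 else 0))" for j s
  have "wp I' (WhileLess (m + 4) (m + 9) (try_value m p))
      (\<lambda>t s. t \<le> (\<Sum>v<n. (m + 11) * T v + 4 + 1) + 1 \<and> Inv n s) \<sigma>"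
  proof (rule wp_WhileLess_count)
    fix j R W
    assume "j < n" and "Inv j (R, W)"
    then obtain F where sim: "ready m F (R, W)"
      and F: "F (m + 2) = 2" "F (m + 3) = real x" "F (m + 4) = real j" "F (m + 5) = 0"
        "F (m + 6) = 1" "F (m + 8) = real y0" "F (m + 9) = real n"
        "F (m + 10) = (if \<exists>v<j. g v \<noteq> y0 then 1 else 0)"
      unfolding Inv_def by blast
    have "R (m + 4) < R (m + 9)"
      using simulatesD(2)[OF sim] F \<open>j < n\<close> by simp
    moreover have "wp I' (try_value m p) (\<lambda>t s. t \<le> (m + 11) * T j + 4 \<and> Inv (Suc j) s) (R, W)"
    proof (rule wp_mono[OF wp_try_value[OF comp[OF \<open>j < n\<close>] regs sim F(1-6) K SucK other]])
      fix t s
      assume *: "t \<le> (m + 11) * T j + 4 \<and> ready m (F(m + 7 := real (g j),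
          m + 10 := if g j = y0 then F (m + 10) else 1, m + 4 := real j + 1)) s"
      have "Inv (Suc j) s"
        unfolding Inv_def
        by (rule exI, rule conjI, rule conjunct2[OF *]) (use F in \<open>auto simp: less_Suc_eq\<close>)
      then show "t \<le> (m + 11) * T j + 4 \<and> Inv (Suc j) s" using * by simp
    qed
    ultimately show "R (m + 4) < R (m + 9) \<and>
      wp I' (try_value m p) (\<lambda>t s. t \<le> (m + 11) * T j + 4 \<and> Inv (Suc j) s) (R, W)" by simp
  next
    fix R W
    assume "Inv n (R, W)"
    then obtain F where "ready m F (R, W)" "F (m + 4) = real n" "F (m + 9) = real n"
      unfolding Inv_def by blast
    then show "\<not> R (m + 4) < R (m + 9)" using simulatesD(2)[of m F 0] by simp
  next
    show "Inv 0 \<sigma>" unfolding Inv_def using ready F by (intro exI[of _ F]) simp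
  qed
  then show ?thesis
  proof (rule wp_mono)
    fix t s
    assume *: "t \<le> (\<Sum>v<n. (m + 11) * T v + 4 + 1) + 1 \<and> Inv n s"
    obtain R W where s: "s = (R, W)" by (cases s)
    obtain F where "ready m F (R, W)" "F (m + 5) = 0"
        "F (m + 10) = (if \<exists>v<n. g v \<noteq> y0 then 1 else 0)"
      using conjunct2[OF *] unfolding Inv_def s by blast
    then have "R (m + 5) = 0" "R (m + 10) = (if \<exists>v<n. g v \<noteq> y0 then 1 else 0)"
      using simulatesD(2)[of m F 0] by simp_all
    then show "case s of (R, W) \<Rightarrow> t \<le> (\<Sum>v<n. (m + 11) * T v + 4 + 1) + 1 \<and> R (m + 5) = 0 \<and>
        R (m + 10) = (if \<exists>v<n. g v \<noteq> y0 then 1 else 0)"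
      using * s by simp
  qed
qed

lemma computes_within_pos: "computes_within p I y T \<Longrightarrow> 0 < T"
  unfolding computes_within_def using exec_time_pos by fastforce

lemma decide_necessity_numerical:
  assumes "input_word I 8 0 = real x" "input_word I 2 x = 1" "0 < m" "7 \<le> T"
  shows "computes_within (decide_necessity m p) I 0 T"
  using assms unfolding computes_within_iff_wp decide_necessity_def
  by (simp add: wp_simps)

text \<open>\<open>J v\<close> stands for the evaluation input with \<open>v\<close> as entry of
  \<open>x\<close>. It takes a real so that it also covers the unmodified entity, whose entry is
  \<open>input_word I 7 x\<close>.\<close>

lemma decide_necessity_categorical:
  assumes comp: "\<And>v. v < n \<Longrightarrow> computes_within p (J (real v)) (g v) (T v)"
    and comp0: "computes_within p (J (input_word I 7 x)) y0 T0"
    and regs: "registers p \<subseteq> {..<m}" "0 < m"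
    and K: "\<And>v i. input_word (J v) 7 i = (if i = x then v else input_word I 7 i)"
    and SucK: "\<And>v i. input_word (J v) 8 i = 0"
    and other: "\<And>v k i. k \<noteq> 7 \<Longrightarrow> k \<noteq> 8 \<Longrightarrow> input_word (J v) k i = input_word I k i"
    and I: "input_word I 8 0 = real x" "input_word I 2 x = 0" "input_word I 3 x = real n"
  shows "computes_within (decide_necessity m p) I (if \<exists>v<n. g v \<noteq> y0 then 1 else 0)
    ((m + 23) * (T0 + (\<Sum>v<n. T v)))"
proof -
  have "(\<Sum>v<n. (m + 11) * T v + 4 + 1) \<le> (\<Sum>v<n. (m + 23) * T v)"
  proof (rule sum_mono)
    fix v assume "v \<in> {..<n}"
    then have "0 < T v" using comp computes_within_pos by blast
    then show "(m + 11) * T v + 4 + 1 \<le> (m + 23) * T v"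
      unfolding add_mult_distrib by linarith
  qed
  then have loop_time: "(\<Sum>v<n. (m + 11) * T v + 4 + 1) \<le> (m + 23) * (\<Sum>v<n. T v)"
    by (simp add: sum_distrib_left)
  have "0 < T0" using comp0 computes_within_pos by blast
  \<comment> \<open>The 12 consists of eight steps before the first evaluation, two before the loop,
    the exit from the loop and the final copy; \<open>m + 23\<close> is
    \<open>m + 11 + 12\<close>.\<close>
  then have time: "(m + 11) * T0 + 12 + (\<Sum>v<n. (m + 11) * T v + 4 + 1)
      \<le> (m + 23) * (T0 + (\<Sum>v<n. T v))"
    using loop_time unfolding add_mult_distrib add_mult_distrib2 by linarith
  define y where "y = (if \<exists>v<n. g v \<noteq> y0 then 1 else 0 :: nat)"
  define B where "B = (m + 23) * (T0 + (\<Sum>v<n. T v))"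
  define R where "R = (\<lambda>_. 0 :: real)(m + 1 := 1, m + 2 := 2, m + 6 := 1, m + 3 := real x,
    m + 9 := real n, m + 4 := input_word I 7 x)"
  have R: "R (m + 1) = 1" "R (m + 2) = 2" "R (m + 6) = 1" "R (m + 3) = real x" "R (m + 9) = real n"
    "R (m + 4) = input_word I 7 x" "R (m + 5) = 0" "R (m + 10) = 0"
    unfolding R_def by simp_all
  have "ready m R (R, \<lambda>_. 0)"
    unfolding simulates_def using R(1) by (simp add: R_def)
  from wp_evaluate[OF comp0 regs this R(2) R(4) R(6) R(7) R(3) K]
  have "wp I (evaluate m 7 p)
      (\<lambda>t \<sigma>'. t \<le> (m + 11) * T0 \<and> ready m (R(m + 7 := real y0)) \<sigma>') (R, \<lambda>_. 0)"
    using SucK other by simp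
  then have "wp I (evaluate m 7 p) (\<lambda>t. wp I (Seq (Apply (m + 8) (+) (m + 7) (m + 5))
      (Seq (Const (m + 4) 0) (Seq (WhileLess (m + 4) (m + 9) (try_value m p))
        (Apply 0 (+) (m + 10) (m + 5)))))
      (\<lambda>u (R, W). 8 + (t + u) \<le> B \<and>
        R 0 = real y)) (R, \<lambda>_. 0)"
  proof (rule wp_mono)
    fix t \<sigma>
    assume "t \<le> (m + 11) * T0 \<and> ready m (R(m + 7 := real y0)) \<sigma>"
    moreover obtain R1 W1 where \<sigma>: "\<sigma> = (R1, W1)" by (cases \<sigma>)
    ultimately have t: "t \<le> (m + 11) * T0" and sim: "ready m (R(m + 7 := real y0)) (R1, W1)" by auto
    have R1: "R1 (m + 7) = real y0" "R1 (m + 5) = 0"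
      using simulatesD(2)[OF sim] R by simp_all
    have sim: "ready m (R(m + 7 := real y0, m + 8 := real y0, m + 4 := 0))
        (R1(m + 8 := real y0, m + 4 := 0), W1)"
      by (intro simulates_frame sim) simp_all
    have "wp I (WhileLess (m + 4) (m + 9) (try_value m p))
      (\<lambda>t (R, W). t \<le> (\<Sum>v<n. (m + 11) * T v + 4 + 1) + 1 \<and> R (m + 5) = 0 \<and>
         R (m + 10) = (if \<exists>v<n. g v \<noteq> y0 then 1 else 0))
      (R1(m + 8 := real y0, m + 4 := 0), W1)"
      by (rule wp_try_values[OF comp regs sim _ _ _ _ _ _ _ _ K SucK other])
        (use R in simp_all)
    then have "wp I (WhileLess (m + 4) (m + 9) (try_value m p))
      (\<lambda>u. wp I (Apply 0 (+) (m + 10) (m + 5)) (\<lambda>w (R, W).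
        8 + (t + (1 + (1 + (u + w)))) \<le> B \<and>
        R 0 = real y))
      (R1(m + 8 := real y0, m + 4 := 0), W1)"
      by (rule wp_mono) (use t time in \<open>clarsimp simp: wp_simps y_def B_def simp del: sum.distrib\<close>)
    then show "wp I (Seq (Apply (m + 8) (+) (m + 7) (m + 5))
      (Seq (Const (m + 4) 0) (Seq (WhileLess (m + 4) (m + 9) (try_value m p))
        (Apply 0 (+) (m + 10) (m + 5)))))
      (\<lambda>u (R, W). 8 + (t + u) \<le> B \<and>
        R 0 = real y) \<sigma>"
      using R1 unfolding \<sigma> wp_simps by simp
  qed
  \<comment> \<open>The eight initial unit steps surface as nested successors and are folded
    back.\<close>
  moreover have eight: "Suc (Suc (Suc (Suc (Suc (Suc (Suc (Suc k))))))) = 8 + k" for k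
    by simp
  ultimately show ?thesis
    using I unfolding computes_within_iff_wp decide_necessity_def y_def[symmetric] B_def[symmetric]
    by (simp add: wp_simps R_def fun_upd_twist eight)
qed


section \<open>Deciding necessity by means of evaluation\<close>

lemma length_model_input: "length (model_input M) = 7"
  by (simp add: model_input_def)

lemma input_word_append:
  "input_word (I @ [ws]) k i =
    (if k = length I then if i < length ws then ws ! i else 0 else input_word I k i)"
  by (auto simp: input_word_def nth_append)

lemma input_word_evaluation_input:
  "input_word (evaluation_input M e) k i =
    (if k = 7 then if i < length (domains M) then e i else 0 else input_word (model_input M) k i)"
  by (simp add: evaluation_input_def input_word_append length_model_input)

lemma length_evaluation_input: "length (evaluation_input M e) = 8"
  by (simp add: evaluation_input_def length_model_input)

lemma input_word_necessity_input:
  "input_word (necessity_input M e x) k i =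
    (if k = 8 then if i = 0 then real x else 0 else input_word (evaluation_input M e) k i)"
  by (simp add: necessity_input_def input_word_append length_evaluation_input)

lemma input_word_model_input:
  "input_word (model_input M) 0 2 = real (length (description M))"
  "input_word (model_input M) (Suc 0) i = (if i < length (description M) then description M ! i else 0)"
  "x < length (domains M) \<Longrightarrow> input_word (model_input M) 2 x = domain_words (domains M ! x) ! 0"
  "x < length (domains M) \<Longrightarrow> input_word (model_input M) 3 x = domain_words (domains M ! x) ! 1"
  "7 \<le> k \<Longrightarrow> input_word (model_input M) k i = 0"
  by (simp_all add: model_input_def input_word_def nth_Cons' numeral_2_eq_2 numeral_3_eq_3)

text \<open>Two distinct points of an interval enclose infinitely many others.\<close>

lemma finite_domain_values_Numerical:
  assumes "finite (domain_values (Numerical l u))" "a \<in> domain_values (Numerical l u)"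
  shows "domain_values (Numerical l u) = {a}"
proof -
  have no_interval: False
    if "b \<in> domain_values (Numerical l u)" "c \<in> domain_values (Numerical l u)" "b < c" for b c
  proof -
    have "l \<le> ereal y" "ereal y \<le> u" if "y \<in> {b..c}" for y
      using \<open>b \<in> _\<close> \<open>c \<in> _\<close> that order_trans[of l "ereal b" "ereal y"]
        order_trans[of "ereal y" "ereal c" u] by auto
    then have "{b..c} \<subseteq> domain_values (Numerical l u)" by auto
    then show False
      using assms(1) infinite_Icc[OF \<open>b < c\<close>] finite_subset by blast
  qed
  have "b = a" if "b \<in> domain_values (Numerical l u)" for b
    using no_interval[OF that assms(2)] no_interval[OF assms(2) that]
      linorder_less_linear[of b a] by blast
  then show ?thesis using assms(2) by blast
qed

lemma entities_update:
  assumes "e \<in> entities M" "x \<in> features M" "v \<in> feature_values M x"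
  shows "e(x := v) \<in> entities M"
  using assms by (auto simp: entities_def PiE_iff extensional_def)

lemma necessary_feature_iff:
  assumes "e \<in> entities M" "x \<in> features M"
  shows "necessary_feature M e x \<longleftrightarrow>
    (\<exists>v\<in>feature_values M x. predict M (e(x := v)) \<noteq> predict M e)"
  using assms unfolding necessary_feature_def entities_def
  by (intro necessary_iff_prediction_changes) (simp_all add: features_def)

text \<open>\<open>C\<close> depends on the given program only, through the bound on its registers,
  hence it is uniform over the class.\<close>

lemma necessity_decidable_if_evaluable:
  assumes Ops: "basic_operations \<subseteq> Ops" and eval: "evaluable_within Ops \<M> T"
  shows "\<exists>C. necessity_decidable_within Ops \<M>
    (\<lambda>M e x. C * (T M e + (\<Sum>v\<in>feature_values M x. T M (e(x := v)))))"
proof -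
  obtain p where p: "operations p \<subseteq> Ops" and comp:
    "\<And>M e. M \<in> \<M> \<Longrightarrow> e \<in> entities M \<Longrightarrow>
      computes_within p (evaluation_input M e) (predict M e) (T M e)"
    using eval unfolding evaluable_within_def by blast
  obtain m0 where m0: "\<forall>r\<in>registers p. r < m0"
    using finite_registers finite_nat_set_iff_bounded by blast
  \<comment> \<open>The successor reserves register 0, the output, even for a program that mentions
    no register.\<close>
  define m where "m = Suc m0"
  have m: "registers p \<subseteq> {..<m}" "0 < m"
    using m0 by (auto simp: m_def less_Suc_eq)
  have "computes_within (decide_necessity m p) (necessity_input M e x)
      (if necessary_feature M e x then 1 else 0)
      ((m + 23) * (T M e + (\<Sum>v\<in>feature_values M x. T M (e(x := v)))))"
    if M: "M \<in> \<M>" and e: "e \<in> entities M" and x: "x \<in> features M"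
      and fin: "finite (feature_values M x)" for M e x
  proof -
    have x': "x < length (domains M)" using x by (simp add: features_def)
    have I8: "input_word (necessity_input M e x) 8 0 = real x"
      by (simp add: input_word_necessity_input)
    have ex: "e x \<in> feature_values M x"
      using e x by (auto simp: entities_def)
    show ?thesis
    proof (cases "domains M ! x")
      case (Numerical l u)
      then have "feature_values M x = {e x}"
        using finite_domain_values_Numerical fin ex unfolding feature_values_def by simp
      then have "\<not> necessary_feature M e x"
        using necessary_feature_iff[OF e x] by simp
      moreover have "1 \<le> T M e" using computes_within_pos[OF comp[OF M e]] by simp
      then have "7 \<le> (m + 23) * (T M e + (\<Sum>v\<in>feature_values M x. T M (e(x := v))))"
        by (simp add: add_mult_distrib)
      then have "computes_within (decide_necessity m p) (necessity_input M e x) 0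
          ((m + 23) * (T M e + (\<Sum>v\<in>feature_values M x. T M (e(x := v)))))"
        using Numerical x' m I8
        by (intro decide_necessity_numerical[of _ x])
          (simp_all add: input_word_necessity_input input_word_evaluation_input
            input_word_model_input)
      ultimately show ?thesis by simp
    next
      case (Categorical n)
      then have dom_vals: "feature_values M x = real ` {..<n}" by (simp add: feature_values_def)
      let ?g = "\<lambda>v. predict M (e(x := real v))" and ?T = "\<lambda>v. T M (e(x := real v))"
      have "necessary_feature M e x \<longleftrightarrow> (\<exists>v<n. ?g v \<noteq> predict M e)"
        using necessary_feature_iff[OF e x] dom_vals by auto
      moreover have "(\<Sum>v\<in>feature_values M x. T M (e(x := v))) = (\<Sum>v<n. ?T v)"
        unfolding dom_vals by (simp add: sum.reindex)
      moreover have "computes_within (decide_necessity m p) (necessity_input M e x)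
          (if \<exists>v<n. ?g v \<noteq> predict M e then 1 else 0) ((m + 23) * (T M e + (\<Sum>v<n. ?T v)))"
      proof (rule decide_necessity_categorical[where J = "\<lambda>v. evaluation_input M (e(x := v))" and x = x])
        show "computes_within p (evaluation_input M (e(x := real v))) (?g v) (?T v)" if "v < n" for v
          using comp[OF M] entities_update[OF e x] dom_vals that by simp
        have "input_word (necessity_input M e x) 7 x = e x"
          using x' by (simp add: input_word_necessity_input input_word_evaluation_input)
        then show "computes_within p
            (evaluation_input M (e(x := input_word (necessity_input M e x) 7 x)))
            (predict M e) (T M e)"
          using comp[OF M e] by simp
      qed (use m x' Categorical I8 in \<open>auto simp: input_word_necessity_input
          input_word_evaluation_input input_word_model_input\<close>)
      ultimately show ?thesis by simp
    qed
  qed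
  moreover have "operations (decide_necessity m p) \<subseteq> Ops"
    using operations_decide_necessity Ops p by blast
  ultimately show ?thesis
    unfolding necessity_decidable_within_def by blast
qed

lemma computes_within_mono: "computes_within p I y T \<Longrightarrow> T \<le> T' \<Longrightarrow> computes_within p I y T'"
  unfolding computes_within_def using le_trans by blast

lemma necessity_decidable_within_mono:
  assumes "necessity_decidable_within Ops \<M> T"
    and "\<And>M e x. M \<in> \<M> \<Longrightarrow> e \<in> entities M \<Longrightarrow> x \<in> features M \<Longrightarrow> finite (feature_values M x) \<Longrightarrow>
      T M e x \<le> T' M e x"
  shows "necessity_decidable_within Ops \<M> T'"
  using assms unfolding necessity_decidable_within_def by (meson computes_within_mono)

lemma necessity_decidable_uniform:
  assumes "basic_operations \<subseteq> Ops" "evaluable_within Ops \<M> (\<lambda>M e. eval_time M)"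
  shows "\<exists>C. necessity_decidable_within Ops \<M>
    (\<lambda>M e x. C * (eval_time M * card (feature_values M x)))"
proof -
  obtain C where C: "necessity_decidable_within Ops \<M>
      (\<lambda>M e x. C * (eval_time M + (\<Sum>v\<in>feature_values M x. eval_time M)))"
    using necessity_decidable_if_evaluable[OF assms] by blast
  have "necessity_decidable_within Ops \<M>
    (\<lambda>M e x. (2 * C) * (eval_time M * card (feature_values M x)))"
  proof (rule necessity_decidable_within_mono[OF C])
    fix M e x
    assume "e \<in> entities M" "x \<in> features M" "finite (feature_values M x)"
    \<comment> \<open>The domain contains \<open>e x\<close>, so the extra evaluation on
      \<open>e\<close> at most doubles the total.\<close>
    then have "1 \<le> card (feature_values M x)"
      by (auto simp: Suc_le_eq card_gt_0_iff entities_def)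
    then have "eval_time M \<le> eval_time M * card (feature_values M x)" by simp
    then have "eval_time M + (\<Sum>v\<in>feature_values M x. eval_time M)
        \<le> 2 * (eval_time M * card (feature_values M x))"
      by (simp add: mult.commute)
    then have "C * (eval_time M + (\<Sum>v\<in>feature_values M x. eval_time M))
        \<le> C * (2 * (eval_time M * card (feature_values M x)))"
      by (rule mult_le_mono2)
    then show "C * (eval_time M + (\<Sum>v\<in>feature_values M x. eval_time M))
        \<le> (2 * C) * (eval_time M * card (feature_values M x))" by (simp add: ac_simps)
  qed
  then show ?thesis by blast
qed

section \<open>Polynomial time for boolean binary models\<close>

lemma poly_nat_mono: "a \<le> b \<Longrightarrow> poly q a \<le> poly q b" for q :: "nat poly"
  by (induction q) (simp_all add: add_mono mult_mono)

lemma input_size_append: "input_size (I @ J) = input_size I + input_size J"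
  by (simp add: input_size_def)

text \<open>Words 0 and 1 have sizes 1 and 2, and no word is smaller than 1, so one replaced entry
  adds at most 1.\<close>

lemma input_size_update_bit:
  assumes "x < length (domains M)" "v \<in> {0, 1}"
  shows "input_size (evaluation_input M (e(x := v))) \<le> input_size (evaluation_input M e) + 1"
proof -
  let ?w = "\<lambda>r :: real. 1 + floorlog 2 (nat \<lfloor>r\<rfloor>)"
  have array: "input_size [map f [0..<n]] = (\<Sum>i<n. ?w (f i))" for f :: "nat \<Rightarrow> real" and n
    by (simp add: input_size_def comp_def interv_sum_list_conv_sum_set_nat atLeast0LessThan)
  have "?w v \<le> 2" using assms(2) by (auto simp: floorlog_def)
  then have "(\<Sum>i<length (domains M). ?w ((e(x := v)) i))
      \<le> (\<Sum>i<length (domains M). ?w (e i) + (if i = x then 1 else 0))"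
    by (intro sum_mono) auto
  also have "\<dots> = (\<Sum>i<length (domains M). ?w (e i)) + 1"
    using assms(1) unfolding sum.distrib by simp
  finally show ?thesis
    unfolding evaluation_input_def input_size_append array by simp
qed

lemma boolean_binary_feature_values:
  assumes "boolean_binary M" "x \<in> features M"
  shows "feature_values M x = {0, 1}"
proof -
  have "domains M ! x \<in> set (domains M)" using assms by (simp add: features_def)
  then obtain n where n: "domains M ! x = Categorical n" "card (domain_values (domains M ! x)) = 2"
    using assms by (auto simp: boolean_binary_def)
  then have "n = 2" by (simp add: card_image)
  then show ?thesis using n by (auto simp: feature_values_def lessThan_nat_numeral)
qed

lemma necessity_decidable_boolean_binary:
  assumes boolean: "\<forall>M\<in>\<M>. boolean_binary M" and eval: "evaluable_in_polynomial_time \<M>"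
  shows "necessity_decidable_in_polynomial_time \<M>"
proof -
  obtain q :: "nat poly" where
    "evaluable_within basic_operations \<M> (\<lambda>M e. poly q (input_size (evaluation_input M e)))"
    using eval unfolding evaluable_in_polynomial_time_def by blast
  from necessity_decidable_if_evaluable[OF order.refl this] obtain C where
    C: "necessity_decidable_within basic_operations \<M>
      (\<lambda>M e x. C * (poly q (input_size (evaluation_input M e)) +
        (\<Sum>v\<in>feature_values M x. poly q (input_size (evaluation_input M (e(x := v)))))))"
    by blast
  have "necessity_decidable_within basic_operations \<M>
      (\<lambda>M e x. poly (smult (3 * C) q) (input_size (necessity_input M e x)))"
  proof (rule necessity_decidable_within_mono[OF C])
    fix M e x
    assume M: "M \<in> \<M>" and x: "x \<in> features M"
    have dom_vals: "feature_values M x = {0, 1}"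
      using boolean_binary_feature_values boolean M x by blast
    let ?s = "input_size (necessity_input M e x)"
    \<comment> \<open>The additional array \<open>[real x]\<close> has size at least 1, which pays
      for the growth caused by \<open>e(x := v)\<close>.\<close>
    have "input_size (evaluation_input M e) + 1 \<le> ?s"
      unfolding necessity_input_def input_size_append by (simp add: input_size_def)
    then have "poly q (input_size (evaluation_input M e)) \<le> poly q ?s"
      "v \<in> {0, 1} \<Longrightarrow> poly q (input_size (evaluation_input M (e(x := v)))) \<le> poly q ?s" for v
      using input_size_update_bit[of x M v e] x
      by (auto simp: features_def intro!: poly_nat_mono)
    \<comment> \<open>One evaluation on \<open>e\<close> and one for each of the two values give the
      factor 3.\<close>
    from this(1) this(2)[of 0] this(2)[of 1]
    have "poly q (input_size (evaluation_input M e)) +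
        (\<Sum>v\<in>feature_values M x. poly q (input_size (evaluation_input M (e(x := v)))))
        \<le> 3 * poly q ?s"
      unfolding dom_vals by simp
    then have "C * (poly q (input_size (evaluation_input M e)) +
        (\<Sum>v\<in>feature_values M x. poly q (input_size (evaluation_input M (e(x := v))))))
        \<le> C * (3 * poly q ?s)"
      by (rule mult_le_mono2)
    then show "C * (poly q (input_size (evaluation_input M e)) +
        (\<Sum>v\<in>feature_values M x. poly q (input_size (evaluation_input M (e(x := v))))))
        \<le> poly (smult (3 * C) q) ?s"
      by (simp add: ac_simps)
  qed
  then show ?thesis
    using eval unfolding necessity_decidable_in_polynomial_time_def evaluable_in_polynomial_time_def
    by blast
qed


section \<open>Evaluating DNF formulas\<close>

text \<open>Meant for loops whose course follows the structure of the data: the premise about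
  \<open>S\<close> is the place for the induction hypothesis.\<close>

lemma wp_WhileLess_step:
  fixes A T T' :: nat
  assumes "R a < R b" and "wp I p (\<lambda>t s. t \<le> A \<and> S s) (R, W)"
    and "\<And>s. S s \<Longrightarrow> wp I (WhileLess a b p) (\<lambda>t s. t \<le> T \<and> Q s) s" and "A + T + 1 \<le> T'"
  shows "wp I (WhileLess a b p) (\<lambda>t s. t \<le> T' \<and> Q s) (R, W)"
proof -
  have "wp I p (\<lambda>t. wp I (WhileLess a b p) (\<lambda>u s. t + u + 1 \<le> T' \<and> Q s)) (R, W)"
    using assms(2)
  proof (rule wp_mono)
    fix t s
    assume "t \<le> A \<and> S s"
    then show "wp I (WhileLess a b p) (\<lambda>u s. t + u + 1 \<le> T' \<and> Q s) s"
      using assms(4) by (intro wp_mono[OF assms(3)]) auto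
  qed
  then show ?thesis using assms(1) by (subst wp_WhileLess) simp
qed

definition array_segment :: "input \<Rightarrow> nat \<Rightarrow> nat \<Rightarrow> real list \<Rightarrow> bool" where
  "array_segment I k i ws \<longleftrightarrow> (\<forall>j<length ws. input_word I k (i + j) = ws ! j)"

lemma array_segment_Cons:
  "array_segment I k i (w # ws) \<longleftrightarrow> input_word I k i = w \<and> array_segment I k (Suc i) ws"
  by (auto simp: array_segment_def nth_Cons' less_Suc_eq_0_disj)

text \<open>
  Register 1 is the position in the description, register 2 the length of the description, and
  register 3 tells whether the literals of the current term read so far are satisfied. Since a
  literal \<open>(x, b)\<close> is encoded by \<open>w = (if b then 1 else 2)\<close>, it holds iff \<open>w + e x = 2\<close>.
\<close>

definition dnf_step :: prog where
  "dnf_step = Seq (Read 4 1 1) (Seq (Apply 1 (+) 1 7)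
     (IfLess 9 4
       (Seq (Read 5 1 1) (Seq (Apply 1 (+) 1 7) (Seq (Read 6 7 5) (Seq (Apply 4 (+) 4 6)
         (IfLess 4 8 (Const 3 0) (IfLess 8 4 (Const 3 0) Skip))))))
       (Seq (IfLess 9 3 (Const 0 1) Skip) (Const 3 1))))"

text \<open>The 2 in register 8 is both the target of the literal test and the index of the
  description length in array 0.\<close>

definition evaluate_dnf :: prog where
  "evaluate_dnf = Seq (Const 7 1) (Seq (Const 8 2) (Seq (Read 2 0 8) (Seq (Const 3 1)
     (WhileLess 1 2 dnf_step))))"

definition dnf_state :: "nat \<Rightarrow> nat \<Rightarrow> bool \<Rightarrow> bool \<Rightarrow> state \<Rightarrow> bool" where
  "dnf_state L i r b s \<longleftrightarrow> fst s 0 = of_bool r \<and> fst s 1 = real i \<and> fst s 2 = real L \<and>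
     fst s 3 = of_bool b \<and> fst s 7 = 1 \<and> fst s 8 = 2 \<and> fst s 9 = 0"

lemma wp_dnf_step_literal:
  assumes "dnf_state L i r b (R, W)" "input_word I 1 i = (if c then 1 else 2)"
    and "input_word I 1 (Suc i) = real x" "input_word I 7 x = y" "y = 0 \<or> y = 1"
  shows "wp I dnf_step (\<lambda>t s. t \<le> 10 \<and> dnf_state L (i + 2) r (b \<and> y = of_bool c) s) (R, W)"
proof -
  have R: "R 0 = of_bool r" "R (Suc 0) = real i" "R 2 = real L" "R 3 = of_bool b" "R 7 = 1"
      "R 8 = 2" "R 9 = 0"
    using assms(1) by (simp_all add: dnf_state_def)
  have i: "real i + 1 = real (Suc i)" by simp
  show ?thesis
    using assms(2-5) unfolding dnf_step_def
    by (cases c; cases "y = 0"; cases b) (simp_all add: wp_simps R i dnf_state_def del: of_nat_Suc)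
qed

lemma wp_dnf_step_terminator:
  assumes "dnf_state L i r b (R, W)" "input_word I 1 i = 0"
  shows "wp I dnf_step (\<lambda>t s. t \<le> 10 \<and> dnf_state L (i + 1) (r \<or> b) True s) (R, W)"
proof -
  have R: "R 0 = of_bool r" "R (Suc 0) = real i" "R 2 = real L" "R 3 = of_bool b" "R 7 = 1"
      "R 8 = 2" "R 9 = 0"
    using assms(1) by (simp_all add: dnf_state_def)
  show ?thesis
    using assms(2) unfolding dnf_step_def
    by (cases b) (simp_all add: wp_simps R dnf_state_def)
qed

lemma dnf_words_Cons: "dnf_words (t # \<phi>) = concat (map literal_words t) @ 0 # dnf_words \<phi>"
  by (simp add: dnf_words_def)

text \<open>One flat loop over the words processes a formula of two levels. This is the inner
  induction, over the rest \<open>ls\<close> of a term: \<open>loop\<close> is the outer hypothesis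
  for the later terms, and \<open>b\<close> tells whether the literals already consumed hold. A
  round consumes at least one word and costs at most 10 steps and a test, hence 11 per word.\<close>

lemma wp_dnf_term:
  assumes loop: "\<And>i r s. dnf_state L i r True s \<Longrightarrow> array_segment I 1 i (dnf_words \<phi>) \<Longrightarrow>
      L = i + length (dnf_words \<phi>) \<Longrightarrow>
      wp I (WhileLess 1 2 dnf_step) (\<lambda>t s. t \<le> 11 * length (dnf_words \<phi>) + 1 \<and>
        fst s 0 = of_bool (r \<or> dnf_holds \<phi> e)) s"
    and e: "\<forall>(x, c)\<in>set ls. input_word I 7 x = e x \<and> (e x = 0 \<or> e x = 1)"
    and "dnf_state L i r b s"
    and "array_segment I 1 i (concat (map literal_words ls) @ 0 # dnf_words \<phi>)"
    and "L = i + length (concat (map literal_words ls) @ 0 # dnf_words \<phi>)"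
  shows "wp I (WhileLess 1 2 dnf_step)
    (\<lambda>t s. t \<le> 11 * length (concat (map literal_words ls) @ 0 # dnf_words \<phi>) + 1 \<and>
      fst s 0 = of_bool (r \<or> (b \<and> (\<forall>(x, c)\<in>set ls. e x = (if c then 1 else 0))) \<or> dnf_holds \<phi> e)) s"
  using e assms(3-)
proof (induction ls arbitrary: i b s)
  case Nil
  obtain R W where s: "s = (R, W)" by (cases s)
  have "R 1 < R 2" using Nil by (simp add: dnf_state_def s)
  moreover have "wp I dnf_step (\<lambda>t s. t \<le> 10 \<and> dnf_state L (i + 1) (r \<or> b) True s) (R, W)"
    using Nil by (intro wp_dnf_step_terminator) (simp_all add: s array_segment_Cons)
  ultimately show ?case
    unfolding s
  proof (rule wp_WhileLess_step)
    fix s1 assume "dnf_state L (i + 1) (r \<or> b) True s1"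
    from loop[OF this] show "wp I (WhileLess 1 2 dnf_step)
        (\<lambda>t s. t \<le> 11 * length (dnf_words \<phi>) + 1 \<and> fst s 0 = of_bool
          (r \<or> (b \<and> (\<forall>(x, c)\<in>set []. e x = (if c then 1 else 0))) \<or> dnf_holds \<phi> e)) s1"
      using Nil by (simp add: array_segment_Cons disj_assoc)
  qed simp
next
  case (Cons l ls)
  obtain x c where l: "l = (x, c)" by (cases l)
  have lw: "literal_words (x, c) = [if c then 1 else 2, real x]" by (simp add: literal_words_def)
  obtain R W where s: "s = (R, W)" by (cases s)
  let ?b = "b \<and> e x = of_bool c"
  let ?ws = "concat (map literal_words ls) @ 0 # dnf_words \<phi>"
  have seg: "input_word I 1 i = (if c then 1 else 2)" "input_word I 1 (Suc i) = real x"
      "array_segment I 1 (i + 2) ?ws"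
    using Cons.prems(3) by (simp_all add: l lw array_segment_Cons)
  have "R 1 < R 2" using Cons.prems by (simp add: dnf_state_def s l lw)
  moreover have "wp I dnf_step (\<lambda>t s. t \<le> 10 \<and> dnf_state L (i + 2) r ?b s) (R, W)"
    using Cons.prems seg by (intro wp_dnf_step_literal) (auto simp: s l)
  ultimately show ?case
    unfolding s
  proof (rule wp_WhileLess_step)
    fix s1 assume s1: "dnf_state L (i + 2) r ?b s1"
    have "wp I (WhileLess 1 2 dnf_step) (\<lambda>t s. t \<le> 11 * length ?ws + 1 \<and> fst s 0 = of_bool
        (r \<or> (?b \<and> (\<forall>(x, c)\<in>set ls. e x = (if c then 1 else 0))) \<or> dnf_holds \<phi> e)) s1"
      by (rule Cons.IH[OF _ s1 seg(3)]) (use Cons.prems in \<open>simp_all add: l lw\<close>)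
    moreover have "(?b \<and> (\<forall>(x, c)\<in>set ls. e x = (if c then 1 else 0))) =
        (b \<and> (\<forall>(x, c)\<in>set (l # ls). e x = (if c then 1 else 0)))"
      by (auto simp: l)
    ultimately show "wp I (WhileLess 1 2 dnf_step)
        (\<lambda>t s. t \<le> 11 * length ?ws + 1 \<and> fst s 0 = of_bool
          (r \<or> (b \<and> (\<forall>(x, c)\<in>set (l # ls). e x = (if c then 1 else 0))) \<or> dnf_holds \<phi> e)) s1"
      by simp
  qed (simp add: l lw)
qed

lemma wp_dnf_loop:
  assumes "\<forall>t\<in>set \<phi>. \<forall>(x, c)\<in>set t. input_word I 7 x = e x \<and> (e x = 0 \<or> e x = 1)"
    and "dnf_state L i r True s"
    and "array_segment I 1 i (dnf_words \<phi>)"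
    and "L = i + length (dnf_words \<phi>)"
  shows "wp I (WhileLess 1 2 dnf_step) (\<lambda>t s. t \<le> 11 * length (dnf_words \<phi>) + 1 \<and>
    fst s 0 = of_bool (r \<or> dnf_holds \<phi> e)) s"
  using assms
proof (induction \<phi> arbitrary: i r s)
  case Nil
  obtain R W where s: "s = (R, W)" by (cases s)
  show ?case
    using Nil unfolding s
    by (subst wp_WhileLess) (simp add: dnf_state_def dnf_words_def dnf_holds_def)
next
  case (Cons t \<phi>)
  have "wp I (WhileLess 1 2 dnf_step)
    (\<lambda>u s. u \<le> 11 * length (concat (map literal_words t) @ 0 # dnf_words \<phi>) + 1 \<and>
      fst s 0 = of_bool (r \<or> (True \<and> (\<forall>(x, c)\<in>set t. e x = (if c then 1 else 0))) \<or> dnf_holds \<phi> e)) s"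
    using Cons.prems Cons.IH by (intro wp_dnf_term) (simp_all add: dnf_words_Cons)
  then show ?case by (simp add: dnf_words_Cons dnf_holds_def)
qed

section \<open>Facts shared by DNF formulas and decision diagrams\<close>

lemma feature_values_replicate:
  assumes "domains M = replicate n (Categorical 2)" "x < n"
  shows "feature_values M x = {0, 1}"
  using assms by (auto simp: feature_values_def numeral_2_eq_2 lessThan_Suc)

lemma boolean_binary_replicate:
  assumes "domains M = replicate n (Categorical 2)" "classes M = 2" "\<And>e. predict M e < 2"
  shows "boolean_binary M"
  using assms by (auto simp: boolean_binary_def wf_model_def card_image)

lemma discrete_replicate:
  assumes "domains M = replicate n (Categorical 2)" "set (description M) \<subseteq> \<nat>"
  shows "discrete M"
proof -
  have "domain_words (Categorical 2) ! j \<in> \<nat>" if "j < 5" for j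
  proof -
    have "domain_words (Categorical 2) ! j \<in> set (domain_words (Categorical 2))"
      using that by (intro nth_mem) simp
    also have "\<dots> \<subseteq> \<nat>" by auto
    finally show ?thesis .
  qed
  then have "set ws \<subseteq> \<nat>" if "ws \<in> set (model_input M)" for ws
    using that assms by (auto simp: model_input_def)
  moreover have "feature_values M x \<subseteq> \<nat>" if "x \<in> features M" for x
    using feature_values_replicate[OF assms(1), of x] that assms(1) by (auto simp: features_def)
  ultimately show ?thesis by (auto simp: discrete_def)
qed

text \<open>Every word, even 0, contributes at least 1 to the size; thus time linear in the number
  of words is polynomial.\<close>

lemma length_description_le_input_size:
  "length (description M) \<le> input_size (evaluation_input M e)"
proof -
  have "length ws \<le> (\<Sum>w\<leftarrow>ws. 1 + floorlog 2 (nat \<lfloor>w\<rfloor>))" for ws :: "real list"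
    by (induction ws) auto
  moreover have "(\<Sum>w\<leftarrow>description M. 1 + floorlog 2 (nat \<lfloor>w\<rfloor>)) \<le> input_size (evaluation_input M e)"
    unfolding input_size_def evaluation_input_def model_input_def by (intro member_le_sum_list) simp_all
  ultimately show ?thesis by (rule order_trans)
qed

lemma evaluable_in_polynomial_time_if_linear:
  assumes "\<And>M. M \<in> \<M> \<Longrightarrow> discrete M" "operations p \<subseteq> basic_operations"
    and "\<And>M e. M \<in> \<M> \<Longrightarrow> e \<in> entities M \<Longrightarrow> computes_within p (evaluation_input M e) (predict M e)
      (a * length (description M) + b)"
  shows "evaluable_in_polynomial_time \<M>"
proof -
  have "computes_within p (evaluation_input M e) (predict M e)
      (poly [:b, a:] (input_size (evaluation_input M e)))" if "M \<in> \<M>" "e \<in> entities M" for M e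
    by (rule computes_within_mono[OF assms(3)[OF that]])
      (simp add: length_description_le_input_size mult.commute)
  then show ?thesis
    using assms(1,2) unfolding evaluable_in_polynomial_time_def evaluable_within_def by blast
qed

lemma dnf_models_boolean_binary: "\<forall>M\<in>dnf_models. boolean_binary M"
  by (auto simp: dnf_models_def dnf_model_def intro!: boolean_binary_replicate)

lemma computes_within_evaluate_dnf:
  assumes "\<forall>t\<in>set \<phi>. \<forall>l\<in>set t. fst l < n" and e: "e \<in> entities (dnf_model n \<phi>)"
  shows "computes_within evaluate_dnf (evaluation_input (dnf_model n \<phi>) e)
    (predict (dnf_model n \<phi>) e) (11 * length (dnf_words \<phi>) + 5)"
proof -
  let ?M = "dnf_model n \<phi>"
  let ?I = "evaluation_input ?M e" and ?L = "length (dnf_words \<phi>)"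
  have domains: "domains ?M = replicate n (Categorical 2)" by (simp add: dnf_model_def)
  have literals: "\<forall>t\<in>set \<phi>. \<forall>(x, c)\<in>set t. input_word ?I 7 x = e x \<and> (e x = 0 \<or> e x = 1)"
  proof (intro ballI, clarify)
    fix t x c assume "t \<in> set \<phi>" "(x, c) \<in> set t"
    then have "x < n" using assms(1) by fastforce
    moreover from this have "e x \<in> feature_values ?M x"
      using e domains by (auto simp: entities_def features_def)
    ultimately show "input_word ?I 7 x = e x \<and> (e x = 0 \<or> e x = 1)"
      using feature_values_replicate[OF domains] domains by (auto simp: input_word_evaluation_input)
  qed
  have L: "input_word ?I 0 2 = real ?L"
    by (simp add: input_word_evaluation_input input_word_model_input dnf_model_def)
  have seg: "array_segment ?I 1 0 (dnf_words \<phi>)"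
    by (simp add: array_segment_def input_word_evaluation_input input_word_model_input dnf_model_def)
  have "dnf_state ?L 0 False True
      ((\<lambda>_. 0)(7 := 1, 8 := 2, 2 := real ?L, 3 := 1), \<lambda>_. 0)"
    by (simp add: dnf_state_def)
  from wp_dnf_loop[OF literals this seg]
  have "wp ?I (WhileLess 1 2 dnf_step)
      (\<lambda>t s. t \<le> 11 * ?L + 1 \<and> fst s 0 = of_bool (dnf_holds \<phi> e))
      ((\<lambda>_. 0)(7 := 1, 8 := 2, 2 := real ?L, 3 := 1), \<lambda>_. 0)"
    by simp
  then have "wp ?I (WhileLess 1 2 dnf_step)
      (\<lambda>t (R, W). Suc (Suc (Suc (Suc t))) \<le> 11 * ?L + 5 \<and> R 0 = real (predict ?M e))
      ((\<lambda>_. 0)(7 := 1, 8 := 2, 2 := real ?L, 3 := 1), \<lambda>_. 0)"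
    by (rule wp_mono) (auto simp: dnf_model_def)
  then show ?thesis
    unfolding computes_within_iff_wp evaluate_dnf_def
    by (simp add: wp_simps L)
qed

lemma dnf_models_evaluable: "evaluable_in_polynomial_time dnf_models"
proof (rule evaluable_in_polynomial_time_if_linear)
  have "set (dnf_words \<phi>) \<subseteq> \<nat>" for \<phi>
    by (auto simp: dnf_words_def literal_words_def)
  then have "discrete (dnf_model n \<phi>)" for n \<phi>
    by (intro discrete_replicate[of _ n]) (simp_all add: dnf_model_def)
  then show "discrete M" if "M \<in> dnf_models" for M
    using that by (auto simp: dnf_models_def)
  show "operations evaluate_dnf \<subseteq> basic_operations"
    by (simp add: evaluate_dnf_def dnf_step_def basic_operations_def)
  show "computes_within evaluate_dnf (evaluation_input M e) (predict M e)
      (11 * length (description M) + 5)" if M: "M \<in> dnf_models" and e: "e \<in> entities M" for M e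
  proof -
    obtain n \<phi> where \<phi>: "M = dnf_model n \<phi>" "\<forall>t\<in>set \<phi>. \<forall>l\<in>set t. fst l < n"
      using M by (auto simp: dnf_models_def)
    then have "description M = dnf_words \<phi>" by (simp add: dnf_model_def)
    then show ?thesis using computes_within_evaluate_dnf[OF \<phi>(2)] e \<phi>(1) by simp
  qed
qed


section \<open>Evaluating binary decision diagrams\<close>

text \<open>
  Register 1 is the current node \<open>v\<close>, register 5 the position \<open>3 * v + 1\<close> of its encoding, and
  register 2 the first word of its encoding.
\<close>

definition fetch_node :: prog where
  "fetch_node = Seq (Apply 5 (+) 1 1) (Seq (Apply 5 (+) 5 1) (Seq (Apply 5 (+) 5 7) (Read 2 1 5)))"

text \<open>The first word is \<open>x + 1\<close> at a decision and 0 at a leaf, so the loop runs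
  while it is positive, and subtracting 1 gives the feature. The left and right neighbours are one
  and two words further on.\<close>

definition bdd_step :: prog where
  "bdd_step = Seq (Apply 2 (-) 2 7) (Seq (Read 4 7 2) (Seq (Apply 5 (+) 5 7)
     (Seq (IfLess 9 4 (Apply 5 (+) 5 7) Skip) (Seq (Read 1 1 5) fetch_node))))"

text \<open>Word 0 of the description is the root, so register 9, still 0, serves as its address.
  When the loop ends at a leaf, the next word is the label.\<close>

definition evaluate_bdd :: prog where
  "evaluate_bdd = Seq (Const 7 1) (Seq (Read 1 1 9) (Seq fetch_node
     (Seq (WhileLess 9 2 bdd_step) (Seq (Apply 5 (+) 5 7) (Read 0 1 5)))))"

definition bdd_state :: "input \<Rightarrow> nat \<Rightarrow> state \<Rightarrow> bool" where
  "bdd_state I v s \<longleftrightarrow> fst s 1 = real v \<and> fst s 5 = real (3 * v + 1) \<and>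
     fst s 2 = input_word I 1 (3 * v + 1) \<and> fst s 7 = 1 \<and> fst s 9 = 0"

lemma wp_fetch_node:
  assumes "R 1 = real v" "R 7 = 1" "R 9 = 0"
  shows "wp I fetch_node (\<lambda>t s. t = 4 \<and> bdd_state I v s) (R, W)"
proof -
  have "\<exists>i. 3 * real v + 1 = real i \<and> input_word I 1 i = input_word I 1 (3 * v + 1)"
    by (intro exI[of _ "3 * v + 1"]) simp
  then show ?thesis
    using assms unfolding fetch_node_def by (simp add: wp_simps bdd_state_def)
qed

lemma wp_bdd_step:
  assumes "bdd_state I v (R, W)" "input_word I 1 (3 * v + 1) = real (x + 1)"
    and "input_word I 1 (3 * v + 2) = real l" "input_word I 1 (3 * v + 3) = real r"
    and "input_word I 7 x = y" "y = 0 \<or> y = 1"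
  shows "wp I bdd_step (\<lambda>t s. t \<le> 10 \<and> bdd_state I (if y = 0 then l else r) s) (R, W)"
proof -
  have R: "R (Suc 0) = real v" "R 5 = real (Suc (3 * v))" "R 2 = real (Suc x)" "R 7 = 1" "R 9 = 0"
    using assms(1,2) by (simp_all add: bdd_state_def)
  have arith: "real (Suc x) - 1 = real x" "real (Suc (3 * v)) + 1 = real (Suc (Suc (3 * v)))"
    "real (Suc (Suc (3 * v))) + 1 = real (3 * v + 3)" "2 + real (Suc (3 * v)) = real (3 * v + 3)"
    by simp_all
  have fetch: "wp I fetch_node (\<lambda>t s. t \<le> 4 \<and> bdd_state I w s) (R', W)"
    if "R' (Suc 0) = real w" "R' 7 = 1" "R' 9 = 0" for w R'
    by (rule wp_mono[OF wp_fetch_node[of R']]) (use that in auto)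
  show ?thesis
    using assms(3-6) unfolding bdd_step_def
    by (auto simp: wp_simps R arith fetch simp del: of_nat_add of_nat_mult of_nat_Suc)
qed

lemma bdd_reaches_Leaf: "nodes B ! v = Leaf b \<Longrightarrow> bdd_reaches B e v c \<longleftrightarrow> c = b"
  by (subst bdd_reaches.simps) auto

lemma bdd_reaches_Decision:
  "nodes B ! v = Decision x l r \<Longrightarrow> e x = 0 \<or> e x = 1 \<Longrightarrow>
    bdd_reaches B e v c \<longleftrightarrow> bdd_reaches B e (if e x = 0 then l else r) c"
  by (subst bdd_reaches.simps) auto

lemma wf_bdd_edges: "wf_bdd n B \<Longrightarrow> bdd_edges B \<subseteq> {..<length (nodes B)} \<times> {..<length (nodes B)}"
  unfolding wf_bdd_def bdd_edges_def by (auto dest: nth_mem)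

text \<open>The node \<open>w\<close> is a descendant of \<open>v\<close> but, by acyclicity, not of
  itself.\<close>

lemma descendants_psubset:
  assumes "acyclic E" "(v, w) \<in> E"
  shows "{u. (w, u) \<in> E\<^sup>+} \<subset> {u. (v, u) \<in> E\<^sup>+}"
proof
  show "{u. (w, u) \<in> E\<^sup>+} \<subseteq> {u. (v, u) \<in> E\<^sup>+}"
    using assms(2) by (auto intro: trancl_into_trancl2)
  show "{u. (w, u) \<in> E\<^sup>+} \<noteq> {u. (v, u) \<in> E\<^sup>+}"
    using assms by (auto simp: acyclic_def)
qed

text \<open>The number of proper descendants drops along every edge and is the induction measure.
  Being at most the number of nodes, it also yields linear time.\<close>

lemma wp_bdd_loop:
  assumes wf: "wf_bdd n B"
    and words: "\<And>v k. v < length (nodes B) \<Longrightarrow> k < 3 \<Longrightarrow>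
      input_word I 1 (3 * v + 1 + k) = node_words (nodes B ! v) ! k"
    and e: "\<And>x. x < n \<Longrightarrow> input_word I 7 x = e x \<and> (e x = 0 \<or> e x = 1)"
    and "v < length (nodes B)" "bdd_state I v s"
  shows "wp I (WhileLess 9 2 bdd_step)
    (\<lambda>t s. t \<le> 11 * card {u. (v, u) \<in> (bdd_edges B)\<^sup>+} + 1 \<and> (\<exists>w b. bdd_state I w s \<and>
      w < length (nodes B) \<and> nodes B ! w = Leaf b \<and> (bdd_reaches B e v True \<longleftrightarrow> b))) s"
  using assms(4,5)
proof (induction "card {u. (v, u) \<in> (bdd_edges B)\<^sup>+}" arbitrary: v s rule: less_induct)
  case less
  obtain R W where s: "s = (R, W)" by (cases s)
  have R: "R 9 = 0" "R 2 = node_words (nodes B ! v) ! 0"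
    using less.prems words[of v 0] by (simp_all add: bdd_state_def s)
  show ?case
  proof (cases "nodes B ! v")
    case (Leaf b)
    then have "bdd_reaches B e v True \<longleftrightarrow> b" by (simp add: bdd_reaches_Leaf)
    then show ?thesis
      using R Leaf less.prems unfolding s by (subst wp_WhileLess) auto
  next
    case (Decision x l r)
    let ?w = "if e x = 0 then l else r"
    let ?rank = "\<lambda>v. card {u. (v, u) \<in> (bdd_edges B)\<^sup>+}"
    have "Decision x l r \<in> set (nodes B)" using Decision less.prems by (metis nth_mem)
    then have x: "x < n" and w: "?w < length (nodes B)" using wf by (auto simp: wf_bdd_def)
    have edge: "(v, ?w) \<in> bdd_edges B" using Decision less.prems by (auto simp: bdd_edges_def)
    have "{u. (v, u) \<in> (bdd_edges B)\<^sup>+} \<subseteq> {..<length (nodes B)}"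
      using trancl_subset_Sigma[OF wf_bdd_edges[OF wf]] by auto
    then have "finite {u. (v, u) \<in> (bdd_edges B)\<^sup>+}" by (rule finite_subset) simp
    then have rank: "?rank ?w < ?rank v"
      using wf edge by (intro psubset_card_mono descendants_psubset) (auto simp: wf_bdd_def)
    have "R 9 < R 2" using R Decision by simp
    moreover have "wp I bdd_step (\<lambda>t s. t \<le> 10 \<and> bdd_state I ?w s) (R, W)"
    proof (rule wp_bdd_step[where x = x])
      show "bdd_state I v (R, W)" using less.prems s by simp
    qed (use words[OF less.prems(1), of 0] words[OF less.prems(1), of 1]
        words[OF less.prems(1), of 2] e[OF x] Decision in \<open>simp_all add: numeral_3_eq_3\<close>)
    ultimately show ?thesis
      unfolding s
    proof (rule wp_WhileLess_step)
      fix s1 assume "bdd_state I ?w s1"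
      from less.hyps[OF rank w this]
      show "wp I (WhileLess 9 2 bdd_step)
        (\<lambda>t s. t \<le> 11 * ?rank ?w + 1 \<and> (\<exists>w b. bdd_state I w s \<and>
          w < length (nodes B) \<and> nodes B ! w = Leaf b \<and> (bdd_reaches B e v True \<longleftrightarrow> b))) s1"
        using bdd_reaches_Decision[OF Decision] e[OF x] by simp
    qed (use rank in simp)
  qed
qed

lemma length_node_words: "length (node_words N) = 3"
  by (cases N) auto

lemma length_concat_node_words: "length (concat (map node_words Ns)) = 3 * length Ns"
  by (induction Ns) (simp_all add: length_node_words)

lemma nth_concat_node_words:
  "v < length Ns \<Longrightarrow> k < 3 \<Longrightarrow> concat (map node_words Ns) ! (3 * v + k) = node_words (Ns ! v) ! k"
proof (induction Ns arbitrary: v)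
  case (Cons N Ns)
  then show ?case
    by (cases v) (simp_all add: nth_append length_node_words)
qed simp

lemma bdd_models_boolean_binary: "\<forall>M\<in>bdd_models. boolean_binary M"
  by (auto simp: bdd_models_def bdd_model_def intro!: boolean_binary_replicate)

lemma computes_within_evaluate_bdd:
  assumes wf: "wf_bdd n B" and e: "e \<in> entities (bdd_model n B)"
  shows "computes_within evaluate_bdd (evaluation_input (bdd_model n B) e)
    (predict (bdd_model n B) e) (11 * length (nodes B) + 9)"
proof -
  let ?M = "bdd_model n B"
  let ?I = "evaluation_input ?M e" and ?rank = "card {u. (root B, u) \<in> (bdd_edges B)\<^sup>+}"
  have domains: "domains ?M = replicate n (Categorical 2)" by (simp add: bdd_model_def)
  have dom_vals: "input_word ?I 7 x = e x \<and> (e x = 0 \<or> e x = 1)" if "x < n" for x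
  proof -
    have "e x \<in> feature_values ?M x"
      using that e domains by (auto simp: entities_def features_def)
    then show ?thesis
      using that feature_values_replicate[OF domains that] domains
      by (auto simp: input_word_evaluation_input)
  qed
  have root: "root B < length (nodes B)" using wf by (simp add: wf_bdd_def)
  have desc: "description ?M = real (root B) # concat (map node_words (nodes B))"
    by (simp add: bdd_model_def)
  have root_word: "input_word ?I (Suc 0) 0 = real (root B)"
    by (simp add: input_word_evaluation_input input_word_model_input desc)
  have words: "input_word ?I 1 (3 * v + 1 + k) = node_words (nodes B ! v) ! k"
    if "v < length (nodes B)" "k < 3" for v k
    using that nth_concat_node_words[OF that]
    by (simp add: input_word_evaluation_input input_word_model_input desc length_concat_node_words)
  have "{u. (root B, u) \<in> (bdd_edges B)\<^sup>+} \<subseteq> {..<length (nodes B)}"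
    using trancl_subset_Sigma[OF wf_bdd_edges[OF wf]] by auto
  then have rank: "?rank \<le> length (nodes B)"
    using card_mono[of "{..<length (nodes B)}"] by fastforce
  let ?R = "(\<lambda>_. 0)(7 := 1, Suc 0 := real (root B)) :: nat \<Rightarrow> real"
  have "wp ?I fetch_node (\<lambda>t s. t = 4 \<and> bdd_state ?I (root B) s) (?R, \<lambda>_. 0)"
    by (rule wp_fetch_node) simp_all
  then have "wp ?I fetch_node
      (\<lambda>t. wp ?I (Seq (WhileLess 9 2 bdd_step) (Seq (Apply 5 (+) 5 7) (Read 0 1 5)))
        (\<lambda>u (R, W). Suc (Suc (t + u)) \<le> 11 * length (nodes B) + 9 \<and>
          R 0 = real (predict ?M e))) (?R, \<lambda>_. 0)"
  proof (rule wp_mono)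
    fix t :: nat and s
    assume t: "t = 4 \<and> bdd_state ?I (root B) s"
    then have state: "bdd_state ?I (root B) s" by simp
    show "wp ?I (Seq (WhileLess 9 2 bdd_step) (Seq (Apply 5 (+) 5 7) (Read 0 1 5)))
        (\<lambda>u (R, W). Suc (Suc (t + u)) \<le> 11 * length (nodes B) + 9 \<and>
          R 0 = real (predict ?M e)) s"
      unfolding wp_simps(7)[of _ "WhileLess 9 2 bdd_step"]
    proof (rule wp_mono[OF wp_bdd_loop[OF wf words dom_vals root state]])
      fix u s1
      assume *: "u \<le> 11 * ?rank + 1 \<and> (\<exists>w b. bdd_state ?I w s1 \<and>
        w < length (nodes B) \<and> nodes B ! w = Leaf b \<and> (bdd_reaches B e (root B) True \<longleftrightarrow> b))"
      then obtain w b where w: "bdd_state ?I w s1" "w < length (nodes B)" "nodes B ! w = Leaf b"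
        "bdd_reaches B e (root B) True \<longleftrightarrow> b" by blast
      obtain R W where s1: "s1 = (R, W)" by (cases s1)
      \<comment> \<open>The label of a leaf is the second of its three words, which start at
        \<open>3 * w + 1\<close>.\<close>
      have R: "R 5 + R 7 = real (3 * w + 2)" using w(1) by (simp add: bdd_state_def s1)
      have "input_word ?I (Suc 0) (3 * w + 2) = (if b then 1 else 0)"
        using words[OF w(2), of 1] w(3) by simp
      then show "wp ?I (Seq (Apply 5 (+) 5 7) (Read 0 1 5)) (\<lambda>w (R, W).
        Suc (Suc (t + (u + w))) \<le> 11 * length (nodes B) + 9 \<and> R 0 = real (predict ?M e)) s1"
        using * t rank w(4) unfolding s1
        by (auto simp: wp_simps R bdd_model_def simp del: of_nat_add of_nat_mult
            intro!: exI[of _ "3 * w + 2"])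
    qed
  qed
  then show ?thesis
    unfolding computes_within_iff_wp evaluate_bdd_def
    by (simp add: wp_simps root_word)
qed

lemma bdd_models_evaluable: "evaluable_in_polynomial_time bdd_models"
proof (rule evaluable_in_polynomial_time_if_linear)
  have "set (node_words N) \<subseteq> \<nat>" for N by (cases N) auto
  then have "set (description (bdd_model n B)) \<subseteq> \<nat>" for n B
    by (auto simp: bdd_model_def)
  then have "discrete (bdd_model n B)" for n B
    by (intro discrete_replicate[of _ n]) (simp_all add: bdd_model_def)
  then show "discrete M" if "M \<in> bdd_models" for M
    using that by (auto simp: bdd_models_def)
  show "operations evaluate_bdd \<subseteq> basic_operations"
    by (simp add: evaluate_bdd_def bdd_step_def fetch_node_def basic_operations_def)
  show "computes_within evaluate_bdd (evaluation_input M e) (predict M e)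
      (11 * length (description M) + 9)" if M: "M \<in> bdd_models" and e: "e \<in> entities M" for M e
  proof -
    obtain n B where B: "M = bdd_model n B" "wf_bdd n B"
      using M by (auto simp: bdd_models_def)
    then have "length (nodes B) \<le> length (description M)"
      by (simp add: bdd_model_def length_concat_node_words)
    then show ?thesis
      using computes_within_mono[OF computes_within_evaluate_bdd[OF B(2)]] e B(1) by simp
  qed
qed

text \<open>\<open>C\<close> is fixed for the whole class before model, entity and feature, which is
  the meaning of the O-notation. The last conjuncts place both concrete classes within the scope of
  the polynomial-time part.\<close>

theorem corollary19:
  shows
    "(\<forall>Ops \<M> eval_time.
        basic_operations \<subseteq> Ops \<longrightarrow> (\<forall>M\<in>\<M>. wf_model M) \<longrightarrow>
        evaluable_within Ops \<M> (\<lambda>M e. eval_time M) \<longrightarrow>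
        (\<exists>C. necessity_decidable_within Ops \<M>
               (\<lambda>M e x. C * (eval_time M * card (feature_values M x))))) \<and>
     (\<forall>\<M>. (\<forall>M\<in>\<M>. boolean_binary M) \<longrightarrow> evaluable_in_polynomial_time \<M> \<longrightarrow>
        necessity_decidable_in_polynomial_time \<M>) \<and>
     (\<forall>M\<in>dnf_models. boolean_binary M) \<and> evaluable_in_polynomial_time dnf_models \<and>
     (\<forall>M\<in>bdd_models. boolean_binary M) \<and> evaluable_in_polynomial_time bdd_models"
  using necessity_decidable_uniform necessity_decidable_boolean_binary
    dnf_models_boolean_binary dnf_models_evaluable bdd_models_boolean_binary bdd_models_evaluable
  by blast

end
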